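(* Let $1<p<\infty$ and let $\mu$ be a decomposable measure. Let $M_\mu:L^\infty(\mu)\to\mathcal{B}(L^p(\mu))$ be the representation by multiplication operators, $M_\mu(f)\xi=f\xi$. Then $M_\mu:\min L^\infty(\mu)\to\mathcal{B}(L^p(\mu))$ is a complete isometry; that is, for every $n\in\mathbb{N}$ the amplification $M_\mu^{(n)}:\mathbb{M}_n(\min L^\infty(\mu))\to\mathbb{M}_n(\mathcal{B}(L^p(\mu)))$, $[f_{ij}]\mapsto[M_\mu(f_{ij})]$, is an isometry.
   Context: Scalars are complex. $\ell^p(n)$ is $\mathbb{C}^n$ with the $\ell^p$-norm, and $\mathcal{B}(E)$ denotes the bounded operators on a Banach space $E$. A $p$-operator space is a Banach space $\mathcal{V}$ with norms on $\mathbb{M}_n(\mathcal{V})$, $n\in\mathbb{N}$ (with the norm on $\mathbb{M}_1(\mathcal{V})=\mathcal{V}$ the given one), such that $\|u\oplus v\|=\max\{\|u\|,\|v\|\}$ for $u\in\mathbb{M}_n(\mathcal{V})$, $v\in\mathbb{M}_m(\mathcal{V})$, and $\|\alpha u\beta\|\le\|\alpha\|_{\mathcal{B}(\ell^p(n))}\|u\|\,\|\beta\|_{\mathcal{B}(\ell^p(n))}$ for $u\in\mathbb{M}_n(\mathcal{V})$ and scalar matrices $\alpha,\beta\in\mathbb{M}_n\cong\mathcal{B}(\ell^p(n))$. The space $\mathcal{B}(L^p(\mu))$ is a $p$-operator space via $\mathbb{M}_n(\mathcal{B}(L^p(\mu)))\cong\mathcal{B}(\ell^p(n,L^p(\mu)))$,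 a matrix of operators acting on columns. For a Banach space $\mathcal{X}$, $\min\mathcal{X}$ is the $p$-operator space with $\mathbb{M}_n(\min\mathcal{X})\cong\mathcal{X}\otimes^\lambda\mathcal{B}(\ell^p(n))$ (Banach space injective tensor product), i.e. $\|[x_{ij}]\|=\sup\{\|[\varphi(x_{ij})]\|_{\mathcal{B}(\ell^p(n))}:\varphi\in\mathcal{X}^*,\ \|\varphi\|\le1\}$. A measure $\mu$ is decomposable if $\mu=\sum_{\iota\in I}\mu_\iota$ with each $\mu_\iota$ finite and $\mu_\iota,\mu_{\iota'}$ mutually singular for distinct indices; this is understood as: the underlying space is partitioned into measurable sets $F_\iota$, $\iota\in I$, with $\mu(F_\iota)<\infty$, a set $A$ is measurable iff every $A\cap F_\iota$ is measurable, and $\mu(A)=\sum_\iota\mu(A\cap F_\iota)$ (so $\mu_\iota=\mu|_{F_\iota}$). $L^\infty(\mu)$ consists of locally essentially bounded measurable functions modulo equality locally $\mu$-a.e. (a set is locally null if its intersection with every set of finite measure is null), so that $L^1(\mu)^*\cong L^\infty(\mu)$. *)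

theory Defs
  imports "HOL-Analysis.Analysis"
begin

section \<open>Complex normed spaces with explicit carrier\<close>

text \<open>The spaces below depend on a measure, so they are sets rather than types.\<close>

record 'v cnspace =
  carrier :: "'v set"
  vzero :: 'v
  vadd :: "'v \<Rightarrow> 'v \<Rightarrow> 'v"
  vscale :: "complex \<Rightarrow> 'v \<Rightarrow> 'v"
  vnorm :: "'v \<Rightarrow> real"

definition complex_space :: "complex cnspace" where
  "complex_space = \<lparr>carrier = UNIV, vzero = 0, vadd = (+), vscale = (*), vnorm = cmod\<rparr>"

primrec vsum :: "('v, 'm) cnspace_scheme \<Rightarrow> (nat \<Rightarrow> 'v) \<Rightarrow> nat \<Rightarrow> 'v" where
  "vsum X f 0 = vzero X"
| "vsum X f (Suc n) = vadd X (vsum X f n) (f n)"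

definition linear_map ::
    "('v, 'm) cnspace_scheme \<Rightarrow> ('w, 'k) cnspace_scheme \<Rightarrow> ('v \<Rightarrow> 'w) \<Rightarrow> bool" where
  "linear_map X Y T \<longleftrightarrow>
     T \<in> carrier X \<rightarrow> carrier Y \<and>
     (\<forall>x\<in>carrier X. \<forall>y\<in>carrier X. T (vadd X x y) = vadd Y (T x) (T y)) \<and>
     (\<forall>c. \<forall>x\<in>carrier X. T (vscale X c x) = vscale Y c (T x))"

definition op_bounds ::
    "('v, 'm) cnspace_scheme \<Rightarrow> ('w, 'k) cnspace_scheme \<Rightarrow> ('v \<Rightarrow> 'w) \<Rightarrow> real set" where
  "op_bounds X Y T = {c. 0 \<le> c \<and> (\<forall>x\<in>carrier X. vnorm Y (T x) \<le> c * vnorm X x)}"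

definition op_norm ::
    "('v, 'm) cnspace_scheme \<Rightarrow> ('w, 'k) cnspace_scheme \<Rightarrow> ('v \<Rightarrow> 'w) \<Rightarrow> real" where
  "op_norm X Y T = Inf (op_bounds X Y T)"

text \<open>Operators are made extensional, so that equal operators are equal functions.\<close>

definition bounded_ops ::
    "('v, 'm) cnspace_scheme \<Rightarrow> ('w, 'k) cnspace_scheme \<Rightarrow> ('v \<Rightarrow> 'w) cnspace" where
  "bounded_ops X Y =
     \<lparr>carrier = {T \<in> extensional (carrier X). linear_map X Y T \<and> op_bounds X Y T \<noteq> {}},
      vzero = (\<lambda>x\<in>carrier X. vzero Y),
      vadd = (\<lambda>S T. \<lambda>x\<in>carrier X. vadd Y (S x) (T x)),
      vscale = (\<lambda>c T. \<lambda>x\<in>carrier X. vscale Y c (T x)),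
      vnorm = op_norm X Y\<rparr>"

abbreviation dual_space :: "('v, 'm) cnspace_scheme \<Rightarrow> ('v \<Rightarrow> complex) cnspace" where
  "dual_space X \<equiv> bounded_ops X complex_space"

text \<open>The space \<open>\<ell>\<^sup>p(n, X)\<close>, with coordinates indexed by \<open>0, \<dots>, n - 1\<close>.\<close>

definition lp_sum :: "real \<Rightarrow> nat \<Rightarrow> ('v, 'm) cnspace_scheme \<Rightarrow> (nat \<Rightarrow> 'v) cnspace" where
  "lp_sum p n X =
     \<lparr>carrier = {..<n} \<rightarrow>\<^sub>E carrier X,
      vzero = (\<lambda>i\<in>{..<n}. vzero X),
      vadd = (\<lambda>x y. \<lambda>i\<in>{..<n}. vadd X (x i) (y i)),
      vscale = (\<lambda>c x. \<lambda>i\<in>{..<n}. vscale X c (x i)),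
      vnorm = (\<lambda>x. (\<Sum>i<n. vnorm X (x i) powr p) powr (1 / p))\<rparr>"


section \<open>Matrix norms\<close>

text \<open>
  An \<open>n \<times> n\<close> matrix is a function of two indices of which only the values at
  indices below \<open>n\<close> matter. The field \<open>mnorm\<close> gives the norm on \<open>\<bbbM>\<^sub>n(V)\<close> for each \<open>n\<close>.
\<close>

record 'v p_op_space = "'v cnspace" +
  mnorm :: "nat \<Rightarrow> (nat \<Rightarrow> nat \<Rightarrow> 'v) \<Rightarrow> real"

definition matrices :: "nat \<Rightarrow> ('v, 'm) cnspace_scheme \<Rightarrow> (nat \<Rightarrow> nat \<Rightarrow> 'v) set" where
  "matrices n X = {u. \<forall>i<n. \<forall>j<n. u i j \<in> carrier X}"

definition scalar_matrix_op ::
    "nat \<Rightarrow> (nat \<Rightarrow> nat \<Rightarrow> complex) \<Rightarrow> (nat \<Rightarrow> complex) \<Rightarrow> (nat \<Rightarrow> complex)" where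
  "scalar_matrix_op n a z = (\<lambda>i\<in>{..<n}. \<Sum>j<n. a i j * z j)"

definition scalar_matrix_norm :: "real \<Rightarrow> nat \<Rightarrow> (nat \<Rightarrow> nat \<Rightarrow> complex) \<Rightarrow> real" where
  "scalar_matrix_norm p n a =
     op_norm (lp_sum p n complex_space) (lp_sum p n complex_space) (scalar_matrix_op n a)"

definition operator_matrix_op ::
    "nat \<Rightarrow> ('v, 'm) cnspace_scheme \<Rightarrow> (nat \<Rightarrow> nat \<Rightarrow> 'v \<Rightarrow> 'v) \<Rightarrow> (nat \<Rightarrow> 'v) \<Rightarrow> (nat \<Rightarrow> 'v)" where
  "operator_matrix_op n E T \<xi> = (\<lambda>i\<in>{..<n}. vsum E (\<lambda>j. T i j (\<xi> j)) n)"

text \<open>\<open>\<B>(E)\<close> with \<open>\<bbbM>\<^sub>n(\<B>(E)) = \<B>(\<ell>\<^sup>p(n, E))\<close>, used for \<open>E = L\<^sup>p(\<mu>)\<close>.\<close>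

definition ops_p_op_space ::
    "real \<Rightarrow> ('v, 'm) cnspace_scheme \<Rightarrow> ('v \<Rightarrow> 'v) p_op_space" where
  "ops_p_op_space p E = cnspace.extend (bounded_ops E E)
     (p_op_space.fields
       (\<lambda>n T. op_norm (lp_sum p n E) (lp_sum p n E) (operator_matrix_op n E T)))"

definition min_p_op_space :: "real \<Rightarrow> 'v cnspace \<Rightarrow> 'v p_op_space" where
  "min_p_op_space p X = cnspace.extend X
     (p_op_space.fields
       (\<lambda>n x. SUP \<phi>\<in>{\<phi> \<in> carrier (dual_space X). vnorm (dual_space X) \<phi> \<le> 1}.
          scalar_matrix_norm p n (\<lambda>i j. \<phi> (x i j))))"

definition amplification ::
    "('v \<Rightarrow> 'w) \<Rightarrow> (nat \<Rightarrow> nat \<Rightarrow> 'v) \<Rightarrow> (nat \<Rightarrow> nat \<Rightarrow> 'w)" where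
  "amplification T u = (\<lambda>i j. T (u i j))"

definition complete_isometry :: "'v p_op_space \<Rightarrow> 'w p_op_space \<Rightarrow> ('v \<Rightarrow> 'w) \<Rightarrow> bool" where
  "complete_isometry V W T \<longleftrightarrow>
     linear_map V W T \<and>
     (\<forall>n\<ge>1. \<forall>u\<in>matrices n V. mnorm W n (amplification T u) = mnorm V n u)"


section \<open>Decomposable measures\<close>

definition decomposable_measure :: "'a measure \<Rightarrow> 'i set \<Rightarrow> ('i \<Rightarrow> 'a set) \<Rightarrow> bool" where
  "decomposable_measure M I F \<longleftrightarrow>
     (\<forall>i\<in>I. F i \<in> sets M \<and> emeasure M (F i) < \<infinity>) \<and>
     disjoint_family_on F I \<and> (\<Union>i\<in>I. F i) = space M \<and>
     (\<forall>A. A \<subseteq> space M \<longrightarrow> (A \<in> sets M \<longleftrightarrow> (\<forall>i\<in>I. A \<inter> F i \<in> sets M))) \<and>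
     (\<forall>A\<in>sets M. emeasure M A = (\<Sum>\<^sub>\<infinity>i\<in>I. emeasure M (A \<inter> F i)))"

definition locally_AE :: "'a measure \<Rightarrow> ('a \<Rightarrow> bool) \<Rightarrow> bool" where
  "locally_AE M P \<longleftrightarrow>
     (\<forall>E\<in>sets M. emeasure M E < \<infinity> \<longrightarrow> (AE t in M. t \<in> E \<longrightarrow> P t))"


section \<open>Lebesgue spaces as quotients\<close>

text \<open>
  The quotient of a space \<open>L\<close> of complex functions by an equivalence relation \<open>R\<close>
  compatible with the pointwise operations and with the seminorm \<open>N\<close>.
\<close>

definition function_quotient ::
    "('a \<Rightarrow> complex) set \<Rightarrow> (('a \<Rightarrow> complex) \<times> ('a \<Rightarrow> complex)) set \<Rightarrow>
     (('a \<Rightarrow> complex) \<Rightarrow> real) \<Rightarrow> ('a \<Rightarrow> complex) set cnspace" where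
  "function_quotient L R N =
     \<lparr>carrier = L // R,
      vzero = R `` {\<lambda>t. 0},
      vadd = (\<lambda>A B. \<Union>f\<in>A. \<Union>g\<in>B. R `` {\<lambda>t. f t + g t}),
      vscale = (\<lambda>c A. \<Union>f\<in>A. R `` {\<lambda>t. c * f t}),
      vnorm = (\<lambda>A. the_elem (N ` A))\<rparr>"

definition Lp_fun :: "real \<Rightarrow> 'a measure \<Rightarrow> ('a \<Rightarrow> complex) set" where
  "Lp_fun p M = {f \<in> borel_measurable M. integrable M (\<lambda>t. cmod (f t) powr p)}"

definition Lp_rel :: "real \<Rightarrow> 'a measure \<Rightarrow> (('a \<Rightarrow> complex) \<times> ('a \<Rightarrow> complex)) set" where
  "Lp_rel p M = {(f, g). f \<in> Lp_fun p M \<and> g \<in> Lp_fun p M \<and> (AE t in M. f t = g t)}"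

definition Lp_space :: "real \<Rightarrow> 'a measure \<Rightarrow> ('a \<Rightarrow> complex) set cnspace" where
  "Lp_space p M = function_quotient (Lp_fun p M) (Lp_rel p M)
     (\<lambda>f. (\<integral>t. cmod (f t) powr p \<partial>M) powr (1 / p))"

definition Linf_fun :: "'a measure \<Rightarrow> ('a \<Rightarrow> complex) set" where
  "Linf_fun M = {f \<in> borel_measurable M. \<exists>c. locally_AE M (\<lambda>t. cmod (f t) \<le> c)}"

definition Linf_rel :: "'a measure \<Rightarrow> (('a \<Rightarrow> complex) \<times> ('a \<Rightarrow> complex)) set" where
  "Linf_rel M = {(f, g). f \<in> Linf_fun M \<and> g \<in> Linf_fun M \<and> locally_AE M (\<lambda>t. f t = g t)}"

definition Linf_space :: "'a measure \<Rightarrow> ('a \<Rightarrow> complex) set cnspace" where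
  "Linf_space M = function_quotient (Linf_fun M) (Linf_rel M)
     (\<lambda>f. Inf {c. 0 \<le> c \<and> locally_AE M (\<lambda>t. cmod (f t) \<le> c)})"

text \<open>The representation \<open>M\<^sub>\<mu>\<close>: the class of \<open>f\<close> acts by \<open>[\<xi>] \<mapsto> [f \<xi>]\<close>.\<close>

definition mult_rep ::
    "real \<Rightarrow> 'a measure \<Rightarrow> ('a \<Rightarrow> complex) set \<Rightarrow> (('a \<Rightarrow> complex) set \<Rightarrow> ('a \<Rightarrow> complex) set)" where
  "mult_rep p M A =
     (\<lambda>X\<in>carrier (Lp_space p M). \<Union>f\<in>A. \<Union>\<xi>\<in>X. Lp_rel p M `` {\<lambda>t. f t * \<xi> t})"

end

theory Submission
  imports Defs
begin

text \<open>
  Let \<open>[f i j]\<close> be a matrix over L-infinity. Both norms in question are the essential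
  supremum over \<open>t\<close> of the norms of the scalar matrices \<open>[f i j t]\<close> on the
  finite-dimensional lp-space. The proof compares the two norms with the scalar
  matrices, but tests these only on vectors fixed in advance, so that each null
  set is chosen for one function at a time.

  Let \<open>q\<close> be the exponent conjugate to \<open>p\<close>, and for scalar vectors \<open>z\<close> and \<open>w\<close> consider
  the function \<open>g t = \<Sum>i. w i * (\<Sum>j. f i j t * z j)\<close>.

  \<^item> The norm in \<open>min\<close> is at most the operator norm (\<open>scalar_matrix_norm_dual_le\<close>). Let
    \<open>K\<close> bound the operator matrix. Applying it to \<open>z\<close> times an indicator function gives
    that \<open>[f i j t]\<close> maps \<open>z\<close> to a vector of norm at most \<open>K\<close> times that of \<open>z\<close>, for almost
    all \<open>t\<close> in each set of finite measure (\<open>pointwise_bound_from_mult_matrix\<close>). By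
    Hoelder's inequality \<open>cmod (g t)\<close> is then at most \<open>K\<close> times the norms of \<open>z\<close> and \<open>w\<close>. A
    functional \<open>\<phi>\<close> of norm at most one does not increase this bound, and \<open>\<phi>\<close> maps \<open>g\<close> to
    the corresponding form of the matrix \<open>[\<phi> (f i j)]\<close>. Duality between the \<open>p\<close>-norm
    and the \<open>q\<close>-norm finishes the estimate.

  \<^item> The operator norm is at most the norm \<open>m\<close> in \<open>min\<close>
    (\<open>mult_matrix_bound_from_dual_ball\<close>). Every functional of norm at most one maps \<open>g\<close>
    to a number of modulus at most \<open>m\<close> times the norms of \<open>z\<close> and \<open>w\<close>. Averages over sets
    of finite measure, weighted by a unimodular function, are such functionals, so
    the same bound holds for \<open>cmod (g t)\<close> almost everywhere on sets of finite measure
    (\<open>locally_AE_bound_from_dual_ball\<close>). Letting \<open>z\<close> and \<open>w\<close> run through a countable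
    dense set and using continuity, the norm of \<open>[f i j t]\<close> is at most \<open>m\<close> for such \<open>t\<close>,
    and integration gives the bound for the operator matrix
    (\<open>mult_matrix_bound_from_pointwise\<close>).

  A statement that holds almost everywhere on each set of finite measure holds
  almost everywhere on the support of an integrable function
  (\<open>locally_AE_on_support\<close>). This is what lets locally defined functions act on
  Lp-functions and lets integrable functions act as functionals on L-infinity.
\<close>

section \<open>Operator norms\<close>

lemma op_norm_le:
  assumes "c \<in> op_bounds X Y T"
  shows "op_norm X Y T \<le> c"
  unfolding op_norm_def by (rule cInf_lower[OF assms]) (auto simp: op_bounds_def bdd_below_def)

lemma op_norm_nonneg:
  assumes "op_bounds X Y T \<noteq> {}"
  shows "0 \<le> op_norm X Y T"
  unfolding op_norm_def by (rule cInf_greatest[OF assms]) (auto simp: op_bounds_def)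

text \<open>
  The infimum of the bounds is attained: a bound that holds with all constants
  near the infimum survives division by the norm of a vector when that norm is
  positive, and is independent of the constant when it is zero.
\<close>

lemma op_norm_in_op_bounds:
  assumes nonneg: "\<And>x. x \<in> carrier X \<Longrightarrow> 0 \<le> vnorm X x" and ne: "op_bounds X Y T \<noteq> {}"
  shows "op_norm X Y T \<in> op_bounds X Y T"
proof -
  have "vnorm Y (T x) \<le> op_norm X Y T * vnorm X x" if x: "x \<in> carrier X" for x
  proof (cases "vnorm X x = 0")
    case True
    obtain c where "c \<in> op_bounds X Y T" using ne by blast
    with x True show ?thesis by (auto simp: op_bounds_def)
  next
    case False
    with nonneg[OF x] have pos: "0 < vnorm X x" by simp
    have "vnorm Y (T x) / vnorm X x \<le> op_norm X Y T"
      unfolding op_norm_def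
      by (rule cInf_greatest[OF ne]) (use x pos in \<open>auto simp: op_bounds_def divide_simps\<close>)
    with pos show ?thesis by (simp add: divide_simps)
  qed
  with op_norm_nonneg[OF ne] show ?thesis by (simp add: op_bounds_def)
qed


section \<open>Finite-dimensional lp-norms and their duality\<close>

lemma powr_le_powr_iff:
  fixes x y p :: real
  assumes "p > 0" "0 \<le> x" "0 \<le> y"
  shows "x powr p \<le> y powr p \<longleftrightarrow> x \<le> y"
  using assms powr_mono2[of p x y] powr_less_mono2[of p y x] by linarith

lemma root_le_iff_le_powr:
  fixes a b c p :: real
  assumes "p > 0" "0 \<le> a" "0 \<le> b" "0 \<le> c"
  shows "a powr (1 / p) \<le> c * b powr (1 / p) \<longleftrightarrow> a \<le> c powr p * b"
proof -
  have "c * b powr (1 / p) = (c powr p * b) powr (1 / p)"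
    using assms by (simp add: powr_mult powr_powr)
  then show ?thesis using assms by (simp add: powr_le_powr_iff)
qed

definition lp_norm :: "real \<Rightarrow> nat \<Rightarrow> (nat \<Rightarrow> complex) \<Rightarrow> real" where
  "lp_norm p n z = (\<Sum>i<n. cmod (z i) powr p) powr (1 / p)"

lemma lp_norm_nonneg [simp]: "0 \<le> lp_norm p n z"
  by (simp add: lp_norm_def)

lemma lp_norm_cong: "(\<And>i. i < n \<Longrightarrow> z i = w i) \<Longrightarrow> lp_norm p n z = lp_norm p n w"
  by (simp add: lp_norm_def)

lemma lp_norm_powr: "p > 0 \<Longrightarrow> lp_norm p n z powr p = (\<Sum>i<n. cmod (z i) powr p)"
  by (simp add: lp_norm_def powr_powr sum_nonneg)

lemma cmod_le_lp_norm:
  assumes "p > 0" "i < n"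
  shows "cmod (z i) \<le> lp_norm p n z"
proof -
  have "cmod (z i) powr p \<le> (\<Sum>i<n. cmod (z i) powr p)"
    using assms by (intro member_le_sum) auto
  then have "cmod (z i) powr p \<le> lp_norm p n z powr p"
    using assms by (simp add: lp_norm_powr)
  then show ?thesis
    using assms by (simp add: powr_le_powr_iff)
qed

lemma lp_norm_le_iff_powr:
  assumes "p > 0" "0 \<le> c"
  shows "lp_norm p n y \<le> c * lp_norm p n z \<longleftrightarrow>
    (\<Sum>i<n. cmod (y i) powr p) \<le> c powr p * (\<Sum>i<n. cmod (z i) powr p)"
  using assms by (simp add: lp_norm_def root_le_iff_le_powr sum_nonneg)

lemma tendsto_lp_norm:
  assumes "p > 0" "\<And>i. i < n \<Longrightarrow> (\<lambda>k. z k i) \<longlonglongrightarrow> w i"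
  shows "(\<lambda>k. lp_norm p n (z k)) \<longlonglongrightarrow> lp_norm p n w"
  unfolding lp_norm_def using assms
  by (intro tendsto_powr2 tendsto_sum tendsto_norm tendsto_const always_eventually)
     (auto intro!: sum_nonneg)

text \<open>
  Multiplication by the conjugate phase is how both duality arguments below
  produce a norming vector or functional.
\<close>

lemma cnj_sgn_mult: "cnj (sgn z) * z = of_real (cmod z)"
proof (cases "z = 0")
  case False
  have "cnj (sgn z) * z = (z * cnj z) / of_real (cmod z)"
    by (simp add: sgn_eq)
  also have "\<dots> = of_real (cmod z)"
    using False by (simp add: power2_eq_square flip: complex_norm_square)
  finally show ?thesis .
qed simp

lemma lp_norm_Holder:
  assumes p: "p > 1" and q: "q > 1" and pq: "1 / p + 1 / q = 1"
  shows "cmod (\<Sum>i<n. w i * y i) \<le> lp_norm q n w * lp_norm p n y"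
proof -
  define a b where "a = lp_norm q n w" and "b = lp_norm p n y"
  have ab0: "0 \<le> a" "0 \<le> b" by (simp_all add: a_def b_def)
  have tri: "cmod (\<Sum>i<n. w i * y i) \<le> (\<Sum>i<n. cmod (w i) * cmod (y i))"
    by (rule order_trans[OF norm_sum]) (simp add: norm_mult)
  have w0: "cmod (w i) \<le> a" and y0: "cmod (y i) \<le> b" if "i < n" for i
    using that p q by (auto simp: a_def b_def intro: cmod_le_lp_norm)
  show ?thesis
  proof (cases "a = 0 \<or> b = 0")
    case True
    have "(\<Sum>i<n. cmod (w i) * cmod (y i)) = 0"
    proof (rule sum.neutral, safe)
      fix i assume "i < n"
      with True show "cmod (w i) * cmod (y i) = 0" using w0[of i] y0[of i] by auto
    qed
    with tri ab0 show ?thesis by (simp flip: a_def b_def)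
  next
    case False
    with ab0 have pos: "a > 0" "b > 0" by auto
    have "(\<Sum>i<n. (cmod (w i) / a) * (cmod (y i) / b)) \<le>
        (\<Sum>i<n. (cmod (w i) / a) powr q / q + (cmod (y i) / b) powr p / p)"
      using p q pq pos by (intro sum_mono Youngs_inequality) (auto simp: add.commute)
    also have "\<dots> = (\<Sum>i<n. cmod (w i) powr q) / (a powr q) / q +
        (\<Sum>i<n. cmod (y i) powr p) / (b powr p) / p"
      using pos by (simp add: sum.distrib powr_divide sum_divide_distrib)
    also have "\<dots> = 1"
    proof -
      have "a powr q = (\<Sum>i<n. cmod (w i) powr q)" "b powr p = (\<Sum>i<n. cmod (y i) powr p)"
        using p q by (simp_all add: a_def b_def lp_norm_powr)
      moreover have "a powr q > 0" "b powr p > 0" using pos by auto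
      ultimately show ?thesis using pq by simp
    qed
    finally have "(\<Sum>i<n. (cmod (w i) / a) * (cmod (y i) / b)) \<le> 1" .
    moreover have "(\<Sum>i<n. (cmod (w i) / a) * (cmod (y i) / b)) =
        (\<Sum>i<n. cmod (w i) * cmod (y i)) / (a * b)"
      by (simp add: sum_divide_distrib)
    ultimately have "(\<Sum>i<n. cmod (w i) * cmod (y i)) / (a * b) \<le> 1" by simp
    then have "(\<Sum>i<n. cmod (w i) * cmod (y i)) \<le> a * b"
      using pos by (simp add: pos_divide_le_eq)
    with tri show ?thesis by (simp add: a_def b_def)
  qed
qed

text \<open>
  The norming vector of \<open>y\<close> is \<open>w i = cnj (sgn (y i)) * \<bar>y i\<bar> powr (p - 1)\<close>: pairing it
  with \<open>y\<close> gives the sum \<open>S\<close> of the \<open>\<bar>y i\<bar> powr p\<close>, while its own \<open>q\<close>-norm is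
  \<open>S powr (1 / q)\<close>, so the hypothesis leaves \<open>S powr (1 / p) \<le> c\<close>.
\<close>

lemma lp_norm_le_by_duality:
  assumes p: "p > 1" and q: "q > 1" and pq: "1 / p + 1 / q = 1" and c: "0 \<le> c"
    and bound: "\<And>w. cmod (\<Sum>i<n. w i * y i) \<le> c * lp_norm q n w"
  shows "lp_norm p n y \<le> c"
proof -
  define S where "S = (\<Sum>i<n. cmod (y i) powr p)"
  have S0: "0 \<le> S" by (simp add: S_def sum_nonneg)
  define w where "w i = cnj (sgn (y i)) * of_real (cmod (y i) powr (p - 1))" for i
  have "w i * y i = of_real (cmod (y i) powr p)" for i
  proof -
    have "w i * y i = (cnj (sgn (y i)) * y i) * of_real (cmod (y i) powr (p - 1))"
      by (simp add: w_def)
    also have "\<dots> = of_real (cmod (y i) * cmod (y i) powr (p - 1))"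
      by (simp only: cnj_sgn_mult of_real_mult)
    also have "cmod (y i) * cmod (y i) powr (p - 1) = cmod (y i) powr p"
      by (simp add: powr_mult_base)
    finally show ?thesis .
  qed
  then have 1: "cmod (\<Sum>i<n. w i * y i) = S"
    using S0 by (simp add: S_def flip: of_real_sum)
  have "(p - 1) * q = p"
    using p q pq by (simp add: field_simps)
  then have "cmod (w i) powr q = cmod (y i) powr p" for i
    by (cases "y i = 0") (auto simp: w_def norm_mult norm_sgn powr_powr)
  then have 2: "lp_norm q n w = S powr (1 / q)"
    by (simp add: lp_norm_def S_def)
  have le: "S \<le> c * S powr (1 / q)"
    using bound[of w] by (simp only: 1 2)
  show ?thesis
  proof (cases "S = 0")
    case True
    then show ?thesis using c by (simp add: lp_norm_def flip: S_def)
  next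
    case False
    with S0 have pos: "S > 0" by simp
    have "S = S powr (1 / p) * S powr (1 / q)"
      using pos by (simp add: pq flip: powr_add)
    with le have "S powr (1 / p) * S powr (1 / q) \<le> c * S powr (1 / q)" by simp
    then show ?thesis using pos by (simp add: lp_norm_def flip: S_def)
  qed
qed

text \<open>
  An almost-everywhere statement survives only countably many instances, hence
  the need for a countable set of test vectors.
\<close>

lemma countable_dense_vectors:
  obtains D :: "(nat \<Rightarrow> complex) set" where "countable D"
    and "\<And>z. \<exists>s. (\<forall>k. s k \<in> D) \<and> (\<forall>i<n. (\<lambda>k. s k i) \<longlonglongrightarrow> z i)"
proof -
  obtain C :: "complex set" where C: "countable C" "UNIV \<subseteq> closure C"
    by (rule separable)
  have "\<exists>s. (\<forall>k. s k \<in> ({..<n} \<rightarrow>\<^sub>E C)) \<and> (\<forall>i<n. (\<lambda>k. s k i) \<longlonglongrightarrow> z i)" for z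
  proof -
    have "\<forall>i. \<exists>x. (\<forall>k. x k \<in> C) \<and> x \<longlonglongrightarrow> z i"
      using C(2) closure_sequential by blast
    then obtain x where "\<And>i k. x i k \<in> C" "\<And>i. x i \<longlonglongrightarrow> z i" by metis
    then have "(\<forall>k. (\<lambda>i\<in>{..<n}. x i k) \<in> ({..<n} \<rightarrow>\<^sub>E C)) \<and>
        (\<forall>i<n. (\<lambda>k. (\<lambda>i\<in>{..<n}. x i k) i) \<longlonglongrightarrow> z i)"
      by auto
    then show ?thesis by (intro exI[of _ "\<lambda>k. \<lambda>i\<in>{..<n}. x i k"])
  qed
  moreover have "countable ({..<n} \<rightarrow>\<^sub>E C)"
    using C(1) by (intro countable_PiE) auto
  ultimately show ?thesis using that by blast
qed

text \<open>
  Both sides of the estimate for the bilinear form are continuous in the two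
  vectors, so it extends from a dense set to all of them; duality then recovers
  the norm of the image vector.
\<close>

lemma lp_norm_bound_from_dense_forms:
  assumes p: "p > 1" and q: "q > 1" and pq: "1 / p + 1 / q = 1" and c: "0 \<le> c"
    and dense: "\<And>z. \<exists>s. (\<forall>k. s k \<in> D) \<and> (\<forall>i<n. (\<lambda>k. s k i) \<longlonglongrightarrow> z i)"
    and bound: "\<And>z w. z \<in> D \<Longrightarrow> w \<in> D \<Longrightarrow>
      cmod (\<Sum>i<n. w i * (\<Sum>j<n. a i j * z j)) \<le> c * lp_norm p n z * lp_norm q n w"
  shows "lp_norm p n (\<lambda>i. \<Sum>j<n. a i j * z j) \<le> c * lp_norm p n z"
proof (rule lp_norm_le_by_duality[OF p q pq])
  fix w
  obtain s where s: "\<And>k. s k \<in> D" "\<And>i. i < n \<Longrightarrow> (\<lambda>k. s k i) \<longlonglongrightarrow> z i"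
    using dense by metis
  obtain r where r: "\<And>k. r k \<in> D" "\<And>i. i < n \<Longrightarrow> (\<lambda>k. r k i) \<longlonglongrightarrow> w i"
    using dense by metis
  have "(\<lambda>k. cmod (\<Sum>i<n. r k i * (\<Sum>j<n. a i j * s k j)))
      \<longlonglongrightarrow> cmod (\<Sum>i<n. w i * (\<Sum>j<n. a i j * z j))"
    using s r by (intro tendsto_intros) auto
  moreover have "(\<lambda>k. c * lp_norm p n (s k) * lp_norm q n (r k))
      \<longlonglongrightarrow> c * lp_norm p n z * lp_norm q n w"
    using s r p q by (intro tendsto_intros tendsto_lp_norm) auto
  ultimately show "cmod (\<Sum>i<n. w i * (\<Sum>j<n. a i j * z j)) \<le> c * lp_norm p n z * lp_norm q n w"
    by (rule LIMSEQ_le) (use bound s r in blast)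
qed (use c in auto)

text \<open>
  A crude bound whose only purpose is to show that the sets of operator bounds
  are nonempty.
\<close>

lemma matrix_bounded_entries:
  assumes p: "p > 0" and a: "\<And>i j. i < n \<Longrightarrow> j < n \<Longrightarrow> cmod (a i j) \<le> C"
  shows "lp_norm p n (\<lambda>i. \<Sum>j<n. a i j * z j) \<le> real n powr (1 / p) * (real n * C) * lp_norm p n z"
proof (cases "n = 0")
  case False
  define N where "N = real n * C * lp_norm p n z"
  have C: "0 \<le> C" using a[of 0 0] False norm_ge_zero[of "a 0 0"] by linarith
  then have N0: "0 \<le> N" by (simp add: N_def)
  have row: "cmod (\<Sum>j<n. a i j * z j) \<le> N" if "i < n" for i
  proof -
    have "cmod (\<Sum>j<n. a i j * z j) \<le> (\<Sum>j<n. C * lp_norm p n z)"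
      using that p C
      by (intro sum_norm_le) (auto simp: norm_mult intro!: mult_mono a cmod_le_lp_norm)
    then show ?thesis by (simp add: N_def)
  qed
  have "(\<Sum>i<n. cmod (\<Sum>j<n. a i j * z j) powr p) \<le> (\<Sum>i<n. N powr p)"
    using row p by (intro sum_mono powr_mono2) auto
  then have "lp_norm p n (\<lambda>i. \<Sum>j<n. a i j * z j) \<le> (real n * N powr p) powr (1 / p)"
    unfolding lp_norm_def using p by (intro powr_mono2) (auto intro: sum_nonneg)
  also have "\<dots> = real n powr (1 / p) * N"
    using p N0 by (simp add: powr_mult powr_powr)
  finally show ?thesis by (simp add: N_def mult.assoc)
qed (simp add: lp_norm_def)

lemma op_bounds_scalar_matrix:
  "c \<in> op_bounds (lp_sum p n complex_space) (lp_sum p n complex_space) (scalar_matrix_op n a) \<longleftrightarrow>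
     0 \<le> c \<and> (\<forall>z. lp_norm p n (\<lambda>i. \<Sum>j<n. a i j * z j) \<le> c * lp_norm p n z)"
proof -
  have "vnorm (lp_sum p n complex_space) z = lp_norm p n z" for z
    by (simp add: lp_sum_def complex_space_def lp_norm_def)
  moreover have "lp_norm p n (scalar_matrix_op n a z) = lp_norm p n (\<lambda>i. \<Sum>j<n. a i j * z j)" for z
    by (rule lp_norm_cong) (simp add: scalar_matrix_op_def)
  ultimately have eq: "c \<in> op_bounds (lp_sum p n complex_space) (lp_sum p n complex_space)
        (scalar_matrix_op n a) \<longleftrightarrow> 0 \<le> c \<and>
      (\<forall>z\<in>{..<n} \<rightarrow>\<^sub>E UNIV. lp_norm p n (\<lambda>i. \<Sum>j<n. a i j * z j) \<le> c * lp_norm p n z)"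
    by (simp add: op_bounds_def) (simp add: lp_sum_def complex_space_def)
  have "lp_norm p n (\<lambda>i. \<Sum>j<n. a i j * z j) \<le> c * lp_norm p n z"
    if *: "\<forall>z\<in>{..<n} \<rightarrow>\<^sub>E UNIV. lp_norm p n (\<lambda>i. \<Sum>j<n. a i j * z j) \<le> c * lp_norm p n z" for z
  proof -
    have "restrict z {..<n} \<in> {..<n} \<rightarrow>\<^sub>E UNIV" by auto
    from *[rule_format, OF this] show ?thesis
      by (simp cong: lp_norm_cong)
  qed
  then show ?thesis unfolding eq by blast
qed

lemma scalar_matrix_norm_le:
  assumes "0 \<le> c" "\<And>z. lp_norm p n (\<lambda>i. \<Sum>j<n. a i j * z j) \<le> c * lp_norm p n z"
  shows "scalar_matrix_norm p n a \<le> c"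
  unfolding scalar_matrix_norm_def
  by (rule op_norm_le) (use assms in \<open>simp add: op_bounds_scalar_matrix\<close>)

lemma scalar_matrix_norm_bound:
  assumes "p > 0"
  shows "0 \<le> scalar_matrix_norm p n a"
    and "lp_norm p n (\<lambda>i. \<Sum>j<n. a i j * z j) \<le> scalar_matrix_norm p n a * lp_norm p n z"
proof -
  define C where "C = (\<Sum>i<n. \<Sum>j<n. cmod (a i j))"
  have C: "cmod (a i j) \<le> C" if "i < n" "j < n" for i j
  proof -
    have "cmod (a i j) \<le> (\<Sum>j<n. cmod (a i j))"
      using that by (intro member_le_sum) auto
    also have "\<dots> \<le> C"
      unfolding C_def using that
      by (intro member_le_sum[where f = "\<lambda>i. \<Sum>j<n. cmod (a i j)"]) (auto intro: sum_nonneg)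
    finally show ?thesis .
  qed
  have "0 \<le> C" by (auto simp: C_def intro!: sum_nonneg)
  then have "real n powr (1 / p) * (real n * C) \<in>
      op_bounds (lp_sum p n complex_space) (lp_sum p n complex_space) (scalar_matrix_op n a)"
    using matrix_bounded_entries[OF assms C] by (simp add: op_bounds_scalar_matrix)
  then have "scalar_matrix_norm p n a \<in>
      op_bounds (lp_sum p n complex_space) (lp_sum p n complex_space) (scalar_matrix_op n a)"
    unfolding scalar_matrix_norm_def
    by (intro op_norm_in_op_bounds) (auto simp: lp_sum_def)
  then show "0 \<le> scalar_matrix_norm p n a"
    and "lp_norm p n (\<lambda>i. \<Sum>j<n. a i j * z j) \<le> scalar_matrix_norm p n a * lp_norm p n z"
    by (simp_all add: op_bounds_scalar_matrix)
qed


section \<open>Quotients of function spaces\<close>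

lemma vsum_cong: "(\<And>j. j < n \<Longrightarrow> g j = h j) \<Longrightarrow> vsum X g n = vsum X h n"
  by (induction n) auto

text \<open>
  Both Lebesgue spaces are quotients of this kind; the locale computes the
  operations of the quotient on representatives once for both.
\<close>

locale pointwise_quotient =
  fixes L :: "('a \<Rightarrow> complex) set" and R N
  assumes equiv: "equiv L R"
    and zero: "(\<lambda>t. 0) \<in> L"
    and add: "(f, f') \<in> R \<Longrightarrow> (g, g') \<in> R \<Longrightarrow> (\<lambda>t. f t + g t, \<lambda>t. f' t + g' t) \<in> R"
    and scale: "(f, f') \<in> R \<Longrightarrow> (\<lambda>t. c * f t, \<lambda>t. c * f' t) \<in> R"
    and norm_cong: "(f, f') \<in> R \<Longrightarrow> (N f :: real) = N f'"
begin

lemma refl: "f \<in> L \<Longrightarrow> (f, f) \<in> R"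
  using equiv by (auto elim: equivE dest: refl_onD)

lemma rel_mem: "(f, g) \<in> R \<Longrightarrow> f \<in> L \<and> g \<in> L"
  using equiv by (auto elim: equivE)

lemma add_mem: "f \<in> L \<Longrightarrow> g \<in> L \<Longrightarrow> (\<lambda>t. f t + g t) \<in> L"
  using add[OF refl refl] rel_mem by blast

lemma sum_mem:
  assumes "finite K" "\<And>k. k \<in> K \<Longrightarrow> h k \<in> L"
  shows "(\<lambda>t. \<Sum>k\<in>K. h k t) \<in> L"
  using assms by (induction K rule: finite_induct) (auto intro: zero add_mem)

lemma class_eq: "(f, g) \<in> R \<Longrightarrow> R `` {f} = R `` {g}"
  using equiv by (rule equiv_class_eq)

lemma class_mem: "f \<in> L \<Longrightarrow> R `` {f} \<in> carrier (function_quotient L R N)"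
  by (simp add: function_quotient_def quotientI)

lemma carrier_cases:
  assumes "A \<in> carrier (function_quotient L R N)"
  obtains f where "f \<in> L" "A = R `` {f}"
  using assms by (auto simp: function_quotient_def elim: quotientE)

lemma vzero_class: "vzero (function_quotient L R N) = R `` {\<lambda>t. 0}"
  by (simp add: function_quotient_def)

lemma UN_class:
  assumes "f \<in> L" and "\<And>f'. (f, f') \<in> R \<Longrightarrow> H f' = C"
  shows "(\<Union>f'\<in>R `` {f}. H f') = C"
proof -
  have "f \<in> R `` {f}" using refl[OF assms(1)] by blast
  moreover have "H f' = C" if "f' \<in> R `` {f}" for f' using assms(2) that by blast
  ultimately show ?thesis by blast
qed

lemma vadd_class:
  assumes "f \<in> L" "g \<in> L"
  shows "vadd (function_quotient L R N) (R `` {f}) (R `` {g}) = R `` {\<lambda>t. f t + g t}"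
  unfolding function_quotient_def cnspace.simps
  by (rule UN_class[OF assms(1)], rule UN_class[OF assms(2)], rule class_eq[symmetric], rule add)

lemma vscale_class:
  assumes "f \<in> L"
  shows "vscale (function_quotient L R N) c (R `` {f}) = R `` {\<lambda>t. c * f t}"
  unfolding function_quotient_def cnspace.simps
  by (rule UN_class[OF assms], rule class_eq[symmetric], rule scale)

lemma the_elem_class:
  assumes "f \<in> L" and "\<And>f'. (f, f') \<in> R \<Longrightarrow> H f' = H f"
  shows "the_elem (H ` (R `` {f})) = H f"
proof -
  have "H f' = H f" if "f' \<in> R `` {f}" for f'
    using assms(2) that by blast
  moreover have "f \<in> R `` {f}" using refl[OF assms(1)] by blast
  ultimately have "H ` (R `` {f}) = {H f}" by blast
  then show ?thesis by simp
qed

lemma vnorm_class: "f \<in> L \<Longrightarrow> vnorm (function_quotient L R N) (R `` {f}) = N f"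
  by (simp add: function_quotient_def the_elem_class norm_cong)

lemma vsum_class:
  assumes "\<And>j. j < m \<Longrightarrow> h j \<in> L"
  shows "vsum (function_quotient L R N) (\<lambda>j. R `` {h j}) m = R `` {\<lambda>t. \<Sum>j<m. h j t}"
  using assms
proof (induction m)
  case (Suc m)
  then have "(\<lambda>t. \<Sum>j<m. h j t) \<in> L" by (intro sum_mem) auto
  with Suc show ?case by (simp add: vadd_class)
qed (simp add: vzero_class)

end


section \<open>Properties that hold locally almost everywhere\<close>

lemma locally_AE_I [intro?]:
  "(\<And>E. E \<in> sets M \<Longrightarrow> emeasure M E < \<infinity> \<Longrightarrow> AE t in M. t \<in> E \<longrightarrow> P t) \<Longrightarrow> locally_AE M P"
  by (simp add: locally_AE_def)

lemma locally_AE_True: "(\<And>t. P t) \<Longrightarrow> locally_AE M P"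
  by (simp add: locally_AE_def)

lemma locally_AE_mp:
  assumes "locally_AE M P" "\<And>t. P t \<Longrightarrow> Q t"
  shows "locally_AE M Q"
  using assms unfolding locally_AE_def by (auto elim: eventually_mono)

lemma locally_AE_ball_countable:
  assumes "countable K" "\<And>k. k \<in> K \<Longrightarrow> locally_AE M (P k)"
  shows "locally_AE M (\<lambda>t. \<forall>k\<in>K. P k t)"
proof
  fix E assume "E \<in> sets M" "emeasure M E < \<infinity>"
  with assms have "AE t in M. \<forall>k\<in>K. t \<in> E \<longrightarrow> P k t"
    by (subst AE_ball_countable) (auto simp: locally_AE_def)
  then show "AE t in M. t \<in> E \<longrightarrow> (\<forall>k\<in>K. P k t)" by eventually_elim auto
qed

lemma locally_AE_mp2:
  assumes P: "locally_AE M P" and Q: "locally_AE M Q" and R: "\<And>t. P t \<Longrightarrow> Q t \<Longrightarrow> R t"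
  shows "locally_AE M R"
proof
  fix E assume "E \<in> sets M" "emeasure M E < \<infinity>"
  then have "AE t in M. t \<in> E \<longrightarrow> P t" "AE t in M. t \<in> E \<longrightarrow> Q t"
    using P Q by (auto simp: locally_AE_def)
  then show "AE t in M. t \<in> E \<longrightarrow> R t" by eventually_elim (simp add: R)
qed

text \<open>
  An integrable function vanishes off the union of the sets where its norm is at
  least \<open>1 / (m + 1)\<close>, and these have finite measure by Markov's inequality. On such
  a union a local statement holds almost everywhere. This is why locally defined
  functions act on integrable ones.
\<close>

lemma locally_AE_on_support:
  fixes k :: "'a \<Rightarrow> 'b :: {banach, second_countable_topology}"
  assumes k: "integrable M k" and P: "locally_AE M P"
  shows "AE t in M. k t \<noteq> 0 \<longrightarrow> P t"
proof -
  define E where "E m = {t \<in> space M. norm (k t) \<ge> 1 / real (Suc m)}" for m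
  have [measurable]: "k \<in> borel_measurable M" using k by auto
  have "AE t in M. t \<in> E m \<longrightarrow> P t" for m
  proof -
    have "E m \<in> sets M" unfolding E_def by measurable
    moreover have "emeasure M (E m) \<le> ennreal ((1 / (1 / real (Suc m))) * (\<integral>t. norm (k t) \<partial>M))"
      unfolding E_def using k by (intro integral_Markov_inequality) auto
    then have "emeasure M (E m) < \<infinity>"
      using le_less_trans by fastforce
    ultimately show ?thesis using P by (simp add: locally_AE_def)
  qed
  then have "AE t in M. \<forall>m. t \<in> E m \<longrightarrow> P t" by (subst AE_all_countable) simp
  moreover have "AE t in M. t \<in> space M" by (rule AE_space)
  ultimately show ?thesis
  proof eventually_elim
    case (elim t)
    show ?case
    proof
      assume "k t \<noteq> 0"
      then have "0 < norm (k t)" by simp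
      then obtain m where "inverse (real (Suc m)) < norm (k t)"
        using reals_Archimedean by blast
      with elim have "t \<in> E m" by (simp add: E_def inverse_eq_divide)
      with elim show "P t" by blast
    qed
  qed
qed

lemma superlevel_set_finite_measure:
  fixes h :: "'a \<Rightarrow> real"
  assumes [measurable]: "h \<in> borel_measurable M" and E [measurable]: "E \<in> sets M"
    and fin: "emeasure M E < \<infinity>"
  shows "{t \<in> E. c < h t} \<in> sets M" and "emeasure M {t \<in> E. c < h t} < \<infinity>"
proof -
  have "{t \<in> E. c < h t} = E \<inter> {t \<in> space M. c < h t}" using sets.sets_into_space[OF E] by auto
  then show "{t \<in> E. c < h t} \<in> sets M" by simp
  have "emeasure M {t \<in> E. c < h t} \<le> emeasure M E" by (intro emeasure_mono) auto
  then show "emeasure M {t \<in> E. c < h t} < \<infinity>" using fin by (rule le_less_trans)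
qed

text \<open>
  On \<open>B\<close> the function \<open>h - c\<close> is strictly positive, yet its integral over \<open>B\<close> is at
  most zero, so \<open>B\<close> is null.
\<close>

lemma AE_le_from_integral_le:
  fixes h :: "'a \<Rightarrow> real"
  assumes h [measurable]: "h \<in> borel_measurable M" and E [measurable]: "E \<in> sets M"
    and fin: "emeasure M E < \<infinity>"
    and B: "B = {t \<in> E. c < h t}"
    and int: "integrable M (\<lambda>t. indicator B t * h t)"
    and le: "(\<integral>t. indicator B t * h t \<partial>M) \<le> c * measure M B"
  shows "AE t in M. t \<in> E \<longrightarrow> h t \<le> c"
proof -
  have B_sets [measurable]: "B \<in> sets M" and Bfin: "emeasure M B < \<infinity>"
    unfolding B by (rule superlevel_set_finite_measure[OF h E fin])+
  let ?g = "\<lambda>t. indicator B t * h t - c * indicator B t"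
  have cint: "integrable M (\<lambda>t. c * indicator B t)"
    using Bfin by (intro integrable_mult_right) auto
  have gint: "integrable M ?g"
    using int cint by (rule Bochner_Integration.integrable_diff)
  have nn: "0 \<le> ?g t" for t by (auto simp: B indicator_def)
  have "integral\<^sup>L M ?g = (\<integral>t. indicator B t * h t \<partial>M) - c * measure M B"
    using int cint Bfin by (simp add: Int_absorb2 sets.sets_into_space)
  with le have "integral\<^sup>L M ?g \<le> 0" by simp
  moreover have "0 \<le> integral\<^sup>L M ?g" using nn by (intro integral_nonneg_AE) auto
  ultimately have "AE t in M. ?g t = 0"
    using integral_nonneg_eq_0_iff_AE[OF gint] nn by auto
  then show ?thesis
    by eventually_elim (auto simp: B indicator_def split: if_splits)
qed


section \<open>The spaces L-infinity and Lp\<close>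

lemma Linf_fun_bound:
  assumes "f \<in> Linf_fun M"
  obtains c where "0 \<le> c" "locally_AE M (\<lambda>t. cmod (f t) \<le> c)"
proof -
  obtain c where "locally_AE M (\<lambda>t. cmod (f t) \<le> c)" using assms by (auto simp: Linf_fun_def)
  then have "locally_AE M (\<lambda>t. cmod (f t) \<le> max c 0)" by (rule locally_AE_mp) auto
  then show ?thesis using that by (meson max.cobounded2)
qed

lemma Linf_fun_measurable: "f \<in> Linf_fun M \<Longrightarrow> f \<in> borel_measurable M"
  by (simp add: Linf_fun_def)

lemma Linf_fun_add:
  assumes "f \<in> Linf_fun M" "g \<in> Linf_fun M"
  shows "(\<lambda>t. f t + g t) \<in> Linf_fun M"
proof -
  obtain c d where "locally_AE M (\<lambda>t. cmod (f t) \<le> c)" "locally_AE M (\<lambda>t. cmod (g t) \<le> d)"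
    using assms by (auto simp: Linf_fun_def)
  then have "locally_AE M (\<lambda>t. cmod (f t + g t) \<le> c + d)"
    by (rule locally_AE_mp2) (rule norm_triangle_mono)
  with assms show ?thesis by (auto simp: Linf_fun_def)
qed

lemma Linf_fun_scale:
  assumes "f \<in> Linf_fun M"
  shows "(\<lambda>t. a * f t) \<in> Linf_fun M"
proof -
  obtain c where "locally_AE M (\<lambda>t. cmod (f t) \<le> c)"
    using assms by (auto simp: Linf_fun_def)
  then have "locally_AE M (\<lambda>t. cmod (a * f t) \<le> cmod a * c)"
    by (rule locally_AE_mp) (auto simp: norm_mult mult_left_mono)
  with assms show ?thesis by (auto simp: Linf_fun_def)
qed

lemma Linf_pointwise_quotient:
  "pointwise_quotient (Linf_fun M) (Linf_rel M)
     (\<lambda>f. Inf {c. 0 \<le> c \<and> locally_AE M (\<lambda>t. cmod (f t) \<le> c)})"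
proof
  show "equiv (Linf_fun M) (Linf_rel M)"
  proof (rule equivI)
    show "refl_on (Linf_fun M) (Linf_rel M)"
      by (simp add: refl_on_def Linf_rel_def locally_AE_True)
    show "sym (Linf_rel M)"
      by (simp add: sym_def Linf_rel_def eq_commute)
    show "trans (Linf_rel M)"
    proof (rule transI)
      fix f g h assume fg: "(f, g) \<in> Linf_rel M" and gh: "(g, h) \<in> Linf_rel M"
      then have "locally_AE M (\<lambda>t. f t = g t)" "locally_AE M (\<lambda>t. g t = h t)"
        by (simp_all add: Linf_rel_def)
      then have "locally_AE M (\<lambda>t. f t = h t)" by (rule locally_AE_mp2) simp
      with fg gh show "(f, h) \<in> Linf_rel M" by (simp add: Linf_rel_def)
    qed
  qed (auto simp: Linf_rel_def)
  show "(\<lambda>t. 0) \<in> Linf_fun M"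
    by (auto simp: Linf_fun_def intro!: exI[of _ 0] locally_AE_True)
  show "(\<lambda>t. f t + g t, \<lambda>t. f' t + g' t) \<in> Linf_rel M"
    if fg: "(f, f') \<in> Linf_rel M" "(g, g') \<in> Linf_rel M" for f f' g g'
  proof -
    have "locally_AE M (\<lambda>t. f t = f' t)" "locally_AE M (\<lambda>t. g t = g' t)"
      using fg by (simp_all add: Linf_rel_def)
    then have "locally_AE M (\<lambda>t. f t + g t = f' t + g' t)" by (rule locally_AE_mp2) simp
    with fg show ?thesis by (simp add: Linf_rel_def Linf_fun_add)
  qed
  show "(\<lambda>t. c * f t, \<lambda>t. c * f' t) \<in> Linf_rel M" if ff: "(f, f') \<in> Linf_rel M" for f f' c
  proof -
    have "locally_AE M (\<lambda>t. f t = f' t)" using ff by (simp add: Linf_rel_def)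
    then have "locally_AE M (\<lambda>t. c * f t = c * f' t)" by (rule locally_AE_mp) simp
    with ff show ?thesis by (simp add: Linf_rel_def Linf_fun_scale)
  qed
  show "Inf {c. 0 \<le> c \<and> locally_AE M (\<lambda>t. cmod (f t) \<le> c)} =
      Inf {c. 0 \<le> c \<and> locally_AE M (\<lambda>t. cmod (f' t) \<le> c)}" if "(f, f') \<in> Linf_rel M" for f f'
  proof -
    have eq: "locally_AE M (\<lambda>t. f t = f' t)" using that by (simp add: Linf_rel_def)
    have "locally_AE M (\<lambda>t. cmod (f t) \<le> c) \<longleftrightarrow> locally_AE M (\<lambda>t. cmod (f' t) \<le> c)" for c
      using locally_AE_mp2[OF eq, of "\<lambda>t. cmod (f t) \<le> c" "\<lambda>t. cmod (f' t) \<le> c"]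
        locally_AE_mp2[OF eq, of "\<lambda>t. cmod (f' t) \<le> c" "\<lambda>t. cmod (f t) \<le> c"] by auto
    then show ?thesis by simp
  qed
qed

lemma Lp_fun_add:
  assumes p: "p > 0" and f: "f \<in> Lp_fun p M" and g: "g \<in> Lp_fun p M"
  shows "(\<lambda>t. f t + g t) \<in> Lp_fun p M"
proof -
  have [measurable]: "f \<in> borel_measurable M" "g \<in> borel_measurable M"
    using f g by (auto simp: Lp_fun_def)
  have "integrable M (\<lambda>t. cmod (f t + g t) powr p)"
  proof (rule Bochner_Integration.integrable_bound)
    show "integrable M (\<lambda>t. 2 powr p * (cmod (f t) powr p + cmod (g t) powr p))"
      using f g by (auto simp: Lp_fun_def)
    show "AE t in M. norm (cmod (f t + g t) powr p) \<le>
        norm (2 powr p * (cmod (f t) powr p + cmod (g t) powr p))"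
    proof (rule AE_I2)
      fix t
      have "cmod (f t + g t) \<le> 2 * max (cmod (f t)) (cmod (g t))"
        by (rule order_trans[OF norm_triangle_ineq]) auto
      then have "cmod (f t + g t) powr p \<le> (2 * max (cmod (f t)) (cmod (g t))) powr p"
        using p by (intro powr_mono2) auto
      also have "\<dots> = 2 powr p * max (cmod (f t)) (cmod (g t)) powr p"
        by (simp add: powr_mult le_max_iff_disj)
      also have "\<dots> \<le> 2 powr p * (cmod (f t) powr p + cmod (g t) powr p)"
        by (intro mult_left_mono) (auto simp: max_def)
      finally show "norm (cmod (f t + g t) powr p) \<le>
          norm (2 powr p * (cmod (f t) powr p + cmod (g t) powr p))" by simp
    qed
  qed measurable
  then show ?thesis by (simp add: Lp_fun_def)
qed

lemma Lp_fun_scale: "f \<in> Lp_fun p M \<Longrightarrow> (\<lambda>t. a * f t) \<in> Lp_fun p M"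
  by (auto simp: Lp_fun_def norm_mult powr_mult)

lemma Lp_pointwise_quotient:
  assumes p: "p > 0"
  shows "pointwise_quotient (Lp_fun p M) (Lp_rel p M)
    (\<lambda>f. (\<integral>t. cmod (f t) powr p \<partial>M) powr (1 / p))"
proof
  show "equiv (Lp_fun p M) (Lp_rel p M)"
  proof (rule equivI)
    show "trans (Lp_rel p M)"
      by (auto simp: trans_def Lp_rel_def)
  qed (auto simp: Lp_rel_def refl_on_def sym_def eq_commute)
  show "(\<lambda>t. 0) \<in> Lp_fun p M" by (auto simp: Lp_fun_def)
  show "(\<lambda>t. f t + g t, \<lambda>t. f' t + g' t) \<in> Lp_rel p M"
    if "(f, f') \<in> Lp_rel p M" "(g, g') \<in> Lp_rel p M" for f f' g g'
    using that p by (auto simp: Lp_rel_def intro: Lp_fun_add)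
  show "(\<lambda>t. c * f t, \<lambda>t. c * f' t) \<in> Lp_rel p M" if "(f, f') \<in> Lp_rel p M" for f f' c
    using that by (auto simp: Lp_rel_def intro: Lp_fun_scale)
  show "(\<integral>t. cmod (f t) powr p \<partial>M) powr (1 / p) = (\<integral>t. cmod (f' t) powr p \<partial>M) powr (1 / p)"
    if "(f, f') \<in> Lp_rel p M" for f f'
  proof -
    have [measurable]: "f \<in> borel_measurable M" "f' \<in> borel_measurable M"
      and ae: "AE t in M. f t = f' t"
      using that by (auto simp: Lp_rel_def Lp_fun_def)
    have "(\<integral>t. cmod (f t) powr p \<partial>M) = (\<integral>t. cmod (f' t) powr p \<partial>M)"
      using ae by (intro integral_cong_AE) auto
    then show ?thesis by simp
  qed
qed

text \<open>
  The essential supremum is itself an essential bound: unite the exceptional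
  sets of the countably many bounds \<open>Inf S + 1 / (m + 1)\<close>.
\<close>

lemma Linf_vnorm_nonneg_and_bound:
  assumes f: "f \<in> Linf_fun M"
  shows "0 \<le> vnorm (Linf_space M) (Linf_rel M `` {f})"
    and "locally_AE M (\<lambda>t. cmod (f t) \<le> vnorm (Linf_space M) (Linf_rel M `` {f}))"
proof -
  define S where "S = {c. 0 \<le> c \<and> locally_AE M (\<lambda>t. cmod (f t) \<le> c)}"
  have norm: "vnorm (Linf_space M) (Linf_rel M `` {f}) = Inf S"
    unfolding Linf_space_def S_def
    by (rule pointwise_quotient.vnorm_class[OF Linf_pointwise_quotient f])
  have ne: "S \<noteq> {}" using Linf_fun_bound[OF f] by (auto simp: S_def)
  then show "0 \<le> vnorm (Linf_space M) (Linf_rel M `` {f})"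
    unfolding norm by (rule cInf_greatest) (auto simp: S_def)
  have "locally_AE M (\<lambda>t. cmod (f t) \<le> Inf S + inverse (real (Suc m)))" for m
  proof -
    obtain c where "c \<in> S" "c < Inf S + inverse (real (Suc m))"
      using cInf_lessD[OF ne, of "Inf S + inverse (real (Suc m))"] by auto
    then show ?thesis by (auto simp: S_def elim: locally_AE_mp)
  qed
  then have "locally_AE M (\<lambda>t. \<forall>m\<in>UNIV. cmod (f t) \<le> Inf S + inverse (real (Suc m)))"
    by (intro locally_AE_ball_countable) auto
  then show "locally_AE M (\<lambda>t. cmod (f t) \<le> vnorm (Linf_space M) (Linf_rel M `` {f}))"
    unfolding norm
  proof (rule locally_AE_mp)
    fix t assume *: "\<forall>m\<in>UNIV. cmod (f t) \<le> Inf S + inverse (real (Suc m))"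
    show "cmod (f t) \<le> Inf S"
    proof (rule ccontr)
      assume "\<not> ?thesis"
      then have "0 < cmod (f t) - Inf S" by simp
      then obtain m where "inverse (real (Suc m)) < cmod (f t) - Inf S"
        using reals_Archimedean by blast
      moreover have "cmod (f t) \<le> Inf S + inverse (real (Suc m))" using * by blast
      ultimately show False by linarith
    qed
  qed
qed

lemma Linf_vnorm_le:
  assumes f: "f \<in> Linf_fun M" and "0 \<le> c" "locally_AE M (\<lambda>t. cmod (f t) \<le> c)"
  shows "vnorm (Linf_space M) (Linf_rel M `` {f}) \<le> c"
  unfolding Linf_space_def pointwise_quotient.vnorm_class[OF Linf_pointwise_quotient f]
  using assms by (intro cInf_lower) (auto simp: bdd_below_def)


abbreviation Linf_class :: "'a measure \<Rightarrow> ('a \<Rightarrow> complex) \<Rightarrow> ('a \<Rightarrow> complex) set" where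
  "Linf_class M f \<equiv> Linf_rel M `` {f}"

abbreviation Lp_class :: "real \<Rightarrow> 'a measure \<Rightarrow> ('a \<Rightarrow> complex) \<Rightarrow> ('a \<Rightarrow> complex) set" where
  "Lp_class p M f \<equiv> Lp_rel p M `` {f}"

lemmas Linf_class_mem = pointwise_quotient.class_mem[OF Linf_pointwise_quotient, folded Linf_space_def]
  and Linf_carrier_cases = pointwise_quotient.carrier_cases[OF Linf_pointwise_quotient, folded Linf_space_def]
  and Linf_vadd = pointwise_quotient.vadd_class[OF Linf_pointwise_quotient, folded Linf_space_def]
  and Linf_vscale = pointwise_quotient.vscale_class[OF Linf_pointwise_quotient, folded Linf_space_def]
  and Linf_fun_zero = pointwise_quotient.zero[OF Linf_pointwise_quotient]
  and Linf_fun_sum = pointwise_quotient.sum_mem[OF Linf_pointwise_quotient]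
  and Linf_UN_class = pointwise_quotient.UN_class[OF Linf_pointwise_quotient]
  and Linf_the_elem_class = pointwise_quotient.the_elem_class[OF Linf_pointwise_quotient]

lemmas Lp_class_mem = pointwise_quotient.class_mem[OF Lp_pointwise_quotient, folded Lp_space_def]
  and Lp_carrier_cases = pointwise_quotient.carrier_cases[OF Lp_pointwise_quotient, folded Lp_space_def]
  and Lp_vadd = pointwise_quotient.vadd_class[OF Lp_pointwise_quotient, folded Lp_space_def]
  and Lp_vscale = pointwise_quotient.vscale_class[OF Lp_pointwise_quotient, folded Lp_space_def]
  and Lp_vnorm = pointwise_quotient.vnorm_class[OF Lp_pointwise_quotient, folded Lp_space_def]
  and Lp_vsum = pointwise_quotient.vsum_class[OF Lp_pointwise_quotient, folded Lp_space_def]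
  and Lp_fun_sum = pointwise_quotient.sum_mem[OF Lp_pointwise_quotient]
  and Lp_UN_class = pointwise_quotient.UN_class[OF Lp_pointwise_quotient]
  and Lp_class_eq = pointwise_quotient.class_eq[OF Lp_pointwise_quotient]

section \<open>Multiplication operators\<close>

lemma Lp_fun_locally_AE:
  assumes x: "x \<in> Lp_fun p M" and P: "locally_AE M P"
  shows "AE t in M. x t \<noteq> 0 \<longrightarrow> P t"
proof -
  have "integrable M (\<lambda>t. cmod (x t) powr p)" using x by (simp add: Lp_fun_def)
  from locally_AE_on_support[OF this P] show ?thesis by simp
qed

lemma mult_powr_le_AE:
  assumes p: "p > 0" and x: "x \<in> Lp_fun p M" and c: "0 \<le> c" "locally_AE M (\<lambda>t. cmod (f t) \<le> c)"
  shows "AE t in M. cmod (f t * x t) powr p \<le> c powr p * cmod (x t) powr p"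
  using Lp_fun_locally_AE[OF x c(2)]
proof eventually_elim
  case (elim t)
  show ?case
  proof (cases "x t = 0")
    case False
    with elim have "cmod (f t) powr p \<le> c powr p"
      using p by (intro powr_mono2) auto
    then show ?thesis by (simp add: norm_mult powr_mult mult_right_mono)
  qed simp
qed

lemma Lp_fun_mult:
  assumes p: "p > 0" and f: "f \<in> Linf_fun M" and x: "x \<in> Lp_fun p M"
  shows "(\<lambda>t. f t * x t) \<in> Lp_fun p M"
proof -
  have [measurable]: "f \<in> borel_measurable M" "x \<in> borel_measurable M"
    using f x by (auto simp: Linf_fun_def Lp_fun_def)
  obtain c where c: "0 \<le> c" "locally_AE M (\<lambda>t. cmod (f t) \<le> c)"
    using Linf_fun_bound[OF f] .
  have "integrable M (\<lambda>t. cmod (f t * x t) powr p)"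
  proof (rule Bochner_Integration.integrable_bound)
    show "integrable M (\<lambda>t. c powr p * cmod (x t) powr p)"
      using x by (simp add: Lp_fun_def)
    show "AE t in M. norm (cmod (f t * x t) powr p) \<le> norm (c powr p * cmod (x t) powr p)"
      using mult_powr_le_AE[OF p x c] by simp
  qed measurable
  then show ?thesis by (simp add: Lp_fun_def)
qed

lemma Lp_rel_mult:
  assumes p: "p > 0" and f: "(f, f') \<in> Linf_rel M" and x: "(x, x') \<in> Lp_rel p M"
  shows "(\<lambda>t. f t * x t, \<lambda>t. f' t * x' t) \<in> Lp_rel p M"
proof -
  have mem: "f \<in> Linf_fun M" "f' \<in> Linf_fun M" "x \<in> Lp_fun p M" "x' \<in> Lp_fun p M"
    and eq: "locally_AE M (\<lambda>t. f t = f' t)" and ae: "AE t in M. x t = x' t"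
    using f x by (simp_all add: Linf_rel_def Lp_rel_def)
  have "AE t in M. f t * x t = f' t * x' t"
    using ae Lp_fun_locally_AE[OF mem(3) eq] by eventually_elim auto
  with mem p show ?thesis by (simp add: Lp_rel_def Lp_fun_mult)
qed

lemma mult_rep_class:
  assumes p: "p > 0" and f: "f \<in> Linf_fun M" and x: "x \<in> Lp_fun p M"
  shows "mult_rep p M (Linf_class M f) (Lp_class p M x) = Lp_class p M (\<lambda>t. f t * x t)"
proof -
  have "(\<Union>f'\<in>Linf_class M f. \<Union>x'\<in>Lp_class p M x. Lp_class p M (\<lambda>t. f' t * x' t)) =
      Lp_class p M (\<lambda>t. f t * x t)"
    by (rule Linf_UN_class[OF f], rule Lp_UN_class[OF p x], rule Lp_class_eq[OF p, symmetric],
        rule Lp_rel_mult[OF p])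
  then show ?thesis using Lp_class_mem[OF p x] by (simp add: mult_rep_def)
qed

lemma mult_rep_bounded:
  assumes p: "p > 0" and f: "f \<in> Linf_fun M" and c: "0 \<le> c" "locally_AE M (\<lambda>t. cmod (f t) \<le> c)"
  shows "c \<in> op_bounds (Lp_space p M) (Lp_space p M) (mult_rep p M (Linf_class M f))"
proof -
  have "vnorm (Lp_space p M) (mult_rep p M (Linf_class M f) A) \<le> c * vnorm (Lp_space p M) A"
    if "A \<in> carrier (Lp_space p M)" for A
    using p that
  proof (rule Lp_carrier_cases)
    fix x assume x: "x \<in> Lp_fun p M" and A: "A = Lp_class p M x"
    have "(\<integral>t. cmod (f t * x t) powr p \<partial>M) \<le> (\<integral>t. c powr p * cmod (x t) powr p \<partial>M)"
    proof (rule integral_mono_AE)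
      show "integrable M (\<lambda>t. cmod (f t * x t) powr p)"
        using Lp_fun_mult[OF p f x] by (simp add: Lp_fun_def)
      show "integrable M (\<lambda>t. c powr p * cmod (x t) powr p)"
        using x by (simp add: Lp_fun_def)
      show "AE t in M. cmod (f t * x t) powr p \<le> c powr p * cmod (x t) powr p"
        by (rule mult_powr_le_AE[OF p x c])
    qed
    then show ?thesis
      using p f x c
      by (simp add: A mult_rep_class Lp_vnorm Lp_fun_mult root_le_iff_le_powr integral_nonneg_AE)
  qed
  with c show ?thesis by (simp add: op_bounds_def)
qed

lemma mult_rep_in_bounded_ops:
  assumes p: "p > 0" and f: "f \<in> Linf_fun M"
  shows "mult_rep p M (Linf_class M f) \<in> carrier (bounded_ops (Lp_space p M) (Lp_space p M))"
proof -
  let ?E = "Lp_space p M"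
  have "linear_map ?E ?E (mult_rep p M (Linf_class M f))"
    unfolding linear_map_def
  proof (intro conjI ballI allI funcsetI)
    fix A assume A: "A \<in> carrier ?E"
    obtain x where x: "x \<in> Lp_fun p M" "A = Lp_class p M x" using Lp_carrier_cases[OF p A] .
    show "mult_rep p M (Linf_class M f) A \<in> carrier ?E"
      using p f x by (simp add: mult_rep_class Lp_class_mem Lp_fun_mult)
    show "mult_rep p M (Linf_class M f) (vscale ?E c A) =
        vscale ?E c (mult_rep p M (Linf_class M f) A)" for c
      using p f x by (simp add: mult_rep_class Lp_vscale Lp_fun_mult Lp_fun_scale mult.left_commute)
    fix B assume B: "B \<in> carrier ?E"
    obtain y where y: "y \<in> Lp_fun p M" "B = Lp_class p M y" using Lp_carrier_cases[OF p B] .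
    show "mult_rep p M (Linf_class M f) (vadd ?E A B) =
        vadd ?E (mult_rep p M (Linf_class M f) A) (mult_rep p M (Linf_class M f) B)"
      using p f x y by (simp add: mult_rep_class Lp_vadd Lp_fun_mult Lp_fun_add distrib_left)
  qed
  moreover have "mult_rep p M (Linf_class M f) \<in> extensional (carrier ?E)"
    by (simp add: mult_rep_def)
  moreover have "op_bounds ?E ?E (mult_rep p M (Linf_class M f)) \<noteq> {}"
    using Linf_fun_bound[OF f] mult_rep_bounded[OF p f] by blast
  ultimately show ?thesis by (simp add: bounded_ops_def)
qed

lemma mult_rep_linear:
  assumes p: "p > 0"
  shows "linear_map (Linf_space M) (bounded_ops (Lp_space p M) (Lp_space p M)) (mult_rep p M)"
  unfolding linear_map_def
proof (intro conjI ballI allI funcsetI)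
  let ?E = "Lp_space p M"
  fix A assume A: "A \<in> carrier (Linf_space M)"
  obtain f where f: "f \<in> Linf_fun M" "A = Linf_class M f" using Linf_carrier_cases[OF A] .
  show "mult_rep p M A \<in> carrier (bounded_ops ?E ?E)"
    using mult_rep_in_bounded_ops[OF p] f by simp
  show "mult_rep p M (vscale (Linf_space M) c A) = vscale (bounded_ops ?E ?E) c (mult_rep p M A)" for c
  proof (rule extensionalityI[of _ "carrier ?E"])
    fix X assume X: "X \<in> carrier ?E"
    obtain x where x: "x \<in> Lp_fun p M" "X = Lp_class p M x" using Lp_carrier_cases[OF p X] .
    have "vscale (bounded_ops ?E ?E) c (mult_rep p M A) X = vscale ?E c (mult_rep p M A X)"
      using X by (simp add: bounded_ops_def)
    then show "mult_rep p M (vscale (Linf_space M) c A) X =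
        vscale (bounded_ops ?E ?E) c (mult_rep p M A) X"
      using p f x
      by (simp add: Linf_vscale mult_rep_class Linf_fun_scale Lp_vscale Lp_fun_mult mult.assoc)
  qed (auto simp: mult_rep_def bounded_ops_def)
  fix B assume B: "B \<in> carrier (Linf_space M)"
  obtain g where g: "g \<in> Linf_fun M" "B = Linf_class M g" using Linf_carrier_cases[OF B] .
  show "mult_rep p M (vadd (Linf_space M) A B) =
      vadd (bounded_ops ?E ?E) (mult_rep p M A) (mult_rep p M B)"
  proof (rule extensionalityI[of _ "carrier ?E"])
    fix X assume X: "X \<in> carrier ?E"
    obtain x where x: "x \<in> Lp_fun p M" "X = Lp_class p M x" using Lp_carrier_cases[OF p X] .
    have "vadd (bounded_ops ?E ?E) (mult_rep p M A) (mult_rep p M B) X =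
        vadd ?E (mult_rep p M A X) (mult_rep p M B X)"
      using X by (simp add: bounded_ops_def)
    then show "mult_rep p M (vadd (Linf_space M) A B) X =
        vadd (bounded_ops ?E ?E) (mult_rep p M A) (mult_rep p M B) X"
      using p f g x
      by (simp add: Linf_vadd mult_rep_class Linf_fun_add Lp_vadd Lp_fun_mult distrib_right)
  qed (auto simp: mult_rep_def bounded_ops_def)
qed


section \<open>Matrices of multiplication operators\<close>

lemma lp_sum_Lp_vnorm:
  assumes p: "p > 0" and x: "\<And>i. i < n \<Longrightarrow> x i \<in> Lp_fun p M"
    and X: "\<And>i. i < n \<Longrightarrow> X i = Lp_class p M (x i)"
  shows "vnorm (lp_sum p n (Lp_space p M)) X =
    (\<integral>t. (\<Sum>i<n. cmod (x i t) powr p) \<partial>M) powr (1 / p)"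
proof -
  have "vnorm (Lp_space p M) (X i) powr p = (\<integral>t. cmod (x i t) powr p \<partial>M)" if "i < n" for i
    using p x[OF that] X[OF that] by (simp add: Lp_vnorm powr_powr integral_nonneg_AE)
  moreover have "(\<integral>t. (\<Sum>i<n. cmod (x i t) powr p) \<partial>M) = (\<Sum>i<n. \<integral>t. cmod (x i t) powr p \<partial>M)"
    using x by (intro Bochner_Integration.integral_sum) (auto simp: Lp_fun_def)
  ultimately show ?thesis by (simp add: lp_sum_def)
qed

text \<open>
  Adding up the \<open>p\<close>-th powers of the coordinate norms merges them into one integral,
  so bounding the operator matrix means comparing two integrals of
  representatives.
\<close>

lemma op_bounds_mult_matrix:
  assumes p: "p > 0" and f: "\<And>i j. i < n \<Longrightarrow> j < n \<Longrightarrow> f i j \<in> Linf_fun M"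
  shows "c \<in> op_bounds (lp_sum p n (Lp_space p M)) (lp_sum p n (Lp_space p M))
      (operator_matrix_op n (Lp_space p M) (\<lambda>i j. mult_rep p M (Linf_class M (f i j)))) \<longleftrightarrow>
    0 \<le> c \<and> (\<forall>x. (\<forall>j<n. x j \<in> Lp_fun p M) \<longrightarrow>
      (\<integral>t. (\<Sum>i<n. cmod (\<Sum>j<n. f i j t * x j t) powr p) \<partial>M) \<le>
      c powr p * (\<integral>t. (\<Sum>j<n. cmod (x j t) powr p) \<partial>M))"
    (is "c \<in> op_bounds ?S ?S ?T \<longleftrightarrow> _ \<and> (\<forall>x. ?mem x \<longrightarrow> ?le x)")
proof -
  have key: "vnorm ?S (?T X) \<le> c * vnorm ?S X \<longleftrightarrow> ?le x"
    if c: "0 \<le> c" and x: "?mem x" and X: "\<And>j. j < n \<Longrightarrow> X j = Lp_class p M (x j)" for x X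
  proof -
    have fx: "(\<lambda>t. f i j t * x j t) \<in> Lp_fun p M" if "i < n" "j < n" for i j
      using p f x that by (intro Lp_fun_mult) auto
    have row: "?T X i = Lp_class p M (\<lambda>t. \<Sum>j<n. f i j t * x j t)" if i: "i < n" for i
    proof -
      have "vsum (Lp_space p M) (\<lambda>j. mult_rep p M (Linf_class M (f i j)) (X j)) n =
          vsum (Lp_space p M) (\<lambda>j. Lp_class p M (\<lambda>t. f i j t * x j t)) n"
        using p f x i by (intro vsum_cong) (simp add: X mult_rep_class)
      also have "\<dots> = Lp_class p M (\<lambda>t. \<Sum>j<n. f i j t * x j t)"
        using fx i by (intro Lp_vsum[OF p]) auto
      finally show ?thesis using i by (simp add: operator_matrix_op_def)
    qed
    have "(\<lambda>t. \<Sum>j<n. f i j t * x j t) \<in> Lp_fun p M" if "i < n" for i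
      using fx that by (intro Lp_fun_sum[OF p]) auto
    then have "vnorm ?S (?T X) = (\<integral>t. (\<Sum>i<n. cmod (\<Sum>j<n. f i j t * x j t) powr p) \<partial>M) powr (1 / p)"
      using row by (intro lp_sum_Lp_vnorm[OF p])
    moreover have "vnorm ?S X = (\<integral>t. (\<Sum>j<n. cmod (x j t) powr p) \<partial>M) powr (1 / p)"
      using x X by (intro lp_sum_Lp_vnorm[OF p]) auto
    ultimately show ?thesis
      using p c by (simp add: root_le_iff_le_powr integral_nonneg_AE sum_nonneg)
  qed
  show ?thesis
  proof (intro iffI conjI allI impI)
    assume c: "c \<in> op_bounds ?S ?S ?T"
    then show c0: "0 \<le> c" by (simp add: op_bounds_def)
    fix x assume x: "?mem x"
    define X where "X = (\<lambda>j\<in>{..<n}. Lp_class p M (x j))"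
    have "X \<in> carrier ?S" using x p by (auto simp: X_def lp_sum_def Lp_class_mem)
    with c have "vnorm ?S (?T X) \<le> c * vnorm ?S X" by (auto simp: op_bounds_def)
    then show "?le x" using key[OF c0 x, of X] by (simp add: X_def)
  next
    assume c: "0 \<le> c \<and> (\<forall>x. ?mem x \<longrightarrow> ?le x)"
    have "vnorm ?S (?T X) \<le> c * vnorm ?S X" if X: "X \<in> carrier ?S" for X
    proof -
      have "\<exists>x. x \<in> Lp_fun p M \<and> X j = Lp_class p M x" if "j < n" for j
      proof -
        have "X j \<in> carrier (Lp_space p M)" using X that by (auto simp: lp_sum_def)
        then show ?thesis using Lp_carrier_cases[OF p] by metis
      qed
      then obtain x where "\<And>j. j < n \<Longrightarrow> x j \<in> Lp_fun p M \<and> X j = Lp_class p M (x j)"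
        by metis
      with c show ?thesis using key[of x X] by blast
    qed
    with c show "c \<in> op_bounds ?S ?S ?T" by (simp add: op_bounds_def)
  qed
qed

text \<open>
  A bound for the scalar matrices \<open>[f i j t]\<close> at almost every \<open>t\<close> can be integrated.
  The points where the given vector of functions is zero contribute nothing, so
  it is enough that the bound holds locally.
\<close>

lemma mult_matrix_bound_from_pointwise:
  assumes p: "p > 0" and f: "\<And>i j. i < n \<Longrightarrow> j < n \<Longrightarrow> f i j \<in> Linf_fun M" and c: "0 \<le> c"
    and bound: "locally_AE M (\<lambda>t. \<forall>z. lp_norm p n (\<lambda>i. \<Sum>j<n. f i j t * z j) \<le> c * lp_norm p n z)"
  shows "c \<in> op_bounds (lp_sum p n (Lp_space p M)) (lp_sum p n (Lp_space p M))
      (operator_matrix_op n (Lp_space p M) (\<lambda>i j. mult_rep p M (Linf_class M (f i j))))"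
proof -
  have "(\<integral>t. (\<Sum>i<n. cmod (\<Sum>j<n. f i j t * x j t) powr p) \<partial>M) \<le>
      c powr p * (\<integral>t. (\<Sum>j<n. cmod (x j t) powr p) \<partial>M)" if x: "\<forall>j<n. x j \<in> Lp_fun p M" for x
  proof -
    have fx: "(\<lambda>t. \<Sum>j<n. f i j t * x j t) \<in> Lp_fun p M" if "i < n" for i
      using p f x that by (intro Lp_fun_sum[OF p] Lp_fun_mult) auto
    have "AE t in M. \<forall>j\<in>{..<n}. x j t \<noteq> 0 \<longrightarrow>
        (\<forall>z. lp_norm p n (\<lambda>i. \<Sum>j<n. f i j t * z j) \<le> c * lp_norm p n z)"
      using Lp_fun_locally_AE[OF _ bound] x by (subst AE_ball_countable) auto
    then have ae: "AE t in M. (\<Sum>i<n. cmod (\<Sum>j<n. f i j t * x j t) powr p) \<le>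
        c powr p * (\<Sum>j<n. cmod (x j t) powr p)"
    proof eventually_elim
      case (elim t)
      show ?case
      proof (cases "\<forall>j<n. x j t = 0")
        case False
        with elim have "lp_norm p n (\<lambda>i. \<Sum>j<n. f i j t * x j t) \<le> c * lp_norm p n (\<lambda>j. x j t)"
          by auto
        then show ?thesis using p c by (simp add: lp_norm_le_iff_powr)
      qed simp
    qed
    have "(\<integral>t. (\<Sum>i<n. cmod (\<Sum>j<n. f i j t * x j t) powr p) \<partial>M) \<le>
        (\<integral>t. c powr p * (\<Sum>j<n. cmod (x j t) powr p) \<partial>M)"
      using fx x ae by (intro integral_mono_AE) (auto simp: Lp_fun_def)
    then show ?thesis by simp
  qed
  with c show ?thesis by (subst op_bounds_mult_matrix[OF p f]) auto
qed

text \<open>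
  The operator matrix is tested on \<open>z\<close> times the indicator function of the set \<open>B\<close>
  where the asserted inequality fails. The vector \<open>z\<close> is fixed before the exceptional
  null set is chosen.
\<close>

lemma pointwise_bound_from_mult_matrix:
  assumes p: "p > 0" and f: "\<And>i j. i < n \<Longrightarrow> j < n \<Longrightarrow> f i j \<in> Linf_fun M"
    and c: "c \<in> op_bounds (lp_sum p n (Lp_space p M)) (lp_sum p n (Lp_space p M))
      (operator_matrix_op n (Lp_space p M) (\<lambda>i j. mult_rep p M (Linf_class M (f i j))))"
  shows "locally_AE M (\<lambda>t. lp_norm p n (\<lambda>i. \<Sum>j<n. f i j t * z j) \<le> c * lp_norm p n z)"
proof
  fix E assume E [measurable]: "E \<in> sets M" and Efin: "emeasure M E < \<infinity>"
  have c0: "0 \<le> c" using c by (simp add: op_bounds_def)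
  have [measurable]: "f i j \<in> borel_measurable M" if "i < n" "j < n" for i j
    using f[OF that] by (rule Linf_fun_measurable)
  define h where "h t = (\<Sum>i<n. cmod (\<Sum>j<n. f i j t * z j) powr p)" for t
  have h_meas [measurable]: "h \<in> borel_measurable M" unfolding h_def by measurable
  define s where "s = c powr p * (\<Sum>j<n. cmod (z j) powr p)"
  define B where "B = {t \<in> E. s < h t}"
  have B_sets [measurable]: "B \<in> sets M" and Bfin: "emeasure M B < \<infinity>"
    unfolding B_def by (rule superlevel_set_finite_measure[OF h_meas E Efin])+
  define x where "x j t = indicator B t * z j" for j t
  have xp: "cmod (x j t) powr p = indicator B t * cmod (z j) powr p" for j t
    by (auto simp: x_def indicator_def)
  have indint: "integrable M (indicator B :: _ \<Rightarrow> real)" using Bfin by simp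
  have x: "x j \<in> Lp_fun p M" for j
  proof -
    have "x j \<in> borel_measurable M" unfolding x_def by measurable
    moreover have "integrable M (\<lambda>t. cmod (x j t) powr p)" unfolding xp using indint by simp
    ultimately show ?thesis by (simp add: Lp_fun_def)
  qed
  have fx: "(\<lambda>t. \<Sum>j<n. f i j t * x j t) \<in> Lp_fun p M" if "i < n" for i
    using p f x that by (intro Lp_fun_sum[OF p] Lp_fun_mult) auto
  have hB: "(\<Sum>i<n. cmod (\<Sum>j<n. f i j t * x j t) powr p) = indicator B t * h t" for t
    by (auto simp: h_def x_def indicator_def)
  have int: "integrable M (\<lambda>t. indicator B t * h t)"
    unfolding hB[symmetric] using fx by (auto simp: Lp_fun_def)
  have "(\<integral>t. indicator B t * h t \<partial>M) \<le> c powr p * (\<integral>t. (\<Sum>j<n. cmod (x j t) powr p) \<partial>M)"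
    using c x unfolding hB[symmetric] by (simp add: op_bounds_mult_matrix[OF p f])
  also have "(\<integral>t. (\<Sum>j<n. cmod (x j t) powr p) \<partial>M) = measure M B * (\<Sum>j<n. cmod (z j) powr p)"
    using sets.sets_into_space[OF B_sets]
    by (simp add: xp Int_absorb2 flip: sum_distrib_left)
  finally have "(\<integral>t. indicator B t * h t \<partial>M) \<le> s * measure M B"
    by (simp add: s_def mult_ac)
  from AE_le_from_integral_le[OF h_meas E Efin B_def int this]
  show "AE t in M. t \<in> E \<longrightarrow> lp_norm p n (\<lambda>i. \<Sum>j<n. f i j t * z j) \<le> c * lp_norm p n z"
    using p c0 by (simp add: lp_norm_le_iff_powr h_def s_def)
qed

lemma mult_matrix_bounded:
  assumes p: "p > 0" and f: "\<And>i j. i < n \<Longrightarrow> j < n \<Longrightarrow> f i j \<in> Linf_fun M"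
  shows "op_bounds (lp_sum p n (Lp_space p M)) (lp_sum p n (Lp_space p M))
      (operator_matrix_op n (Lp_space p M) (\<lambda>i j. mult_rep p M (Linf_class M (f i j)))) \<noteq> {}"
proof -
  have "\<forall>i j. \<exists>c. i < n \<longrightarrow> j < n \<longrightarrow> 0 \<le> c \<and> locally_AE M (\<lambda>t. cmod (f i j t) \<le> c)"
    using Linf_fun_bound f by metis
  then obtain c where c: "\<And>i j. i < n \<Longrightarrow> j < n \<Longrightarrow> 0 \<le> c i j"
    "\<And>i j. i < n \<Longrightarrow> j < n \<Longrightarrow> locally_AE M (\<lambda>t. cmod (f i j t) \<le> c i j)"
    by metis
  define C where "C = (\<Sum>k\<in>{..<n} \<times> {..<n}. c (fst k) (snd k))"
  have C0: "0 \<le> C" unfolding C_def using c by (intro sum_nonneg) auto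
  have cC: "c i j \<le> C" if "i < n" "j < n" for i j
    unfolding C_def
    using that c member_le_sum[of "(i, j)" "{..<n} \<times> {..<n}" "\<lambda>k. c (fst k) (snd k)"] by auto
  have "locally_AE M (\<lambda>t. \<forall>k\<in>{..<n} \<times> {..<n}. cmod (f (fst k) (snd k) t) \<le> c (fst k) (snd k))"
    using c by (intro locally_AE_ball_countable countable_finite) auto
  then have "locally_AE M (\<lambda>t. \<forall>z. lp_norm p n (\<lambda>i. \<Sum>j<n. f i j t * z j) \<le>
      real n powr (1 / p) * (real n * C) * lp_norm p n z)"
  proof (rule locally_AE_mp, intro allI)
    fix t z assume *: "\<forall>k\<in>{..<n} \<times> {..<n}. cmod (f (fst k) (snd k) t) \<le> c (fst k) (snd k)"
    show "lp_norm p n (\<lambda>i. \<Sum>j<n. f i j t * z j) \<le>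
        real n powr (1 / p) * (real n * C) * lp_norm p n z"
      using * cC by (intro matrix_bounded_entries[OF p]) force
  qed
  then have "real n powr (1 / p) * (real n * C) \<in>
      op_bounds (lp_sum p n (Lp_space p M)) (lp_sum p n (Lp_space p M))
      (operator_matrix_op n (Lp_space p M) (\<lambda>i j. mult_rep p M (Linf_class M (f i j))))"
    using C0 p f by (intro mult_matrix_bound_from_pointwise) auto
  then show ?thesis by blast
qed


section \<open>Functionals on L-infinity\<close>

lemma dual_vnorm: "vnorm (dual_space X) \<phi> = op_norm X complex_space \<phi>"
  by (simp add: bounded_ops_def)

lemma Linf_vnorm_nonneg: "A \<in> carrier (Linf_space M) \<Longrightarrow> 0 \<le> vnorm (Linf_space M) A"
  by (erule Linf_carrier_cases) (simp add: Linf_vnorm_nonneg_and_bound(1))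

text \<open>
  A functional of norm at most one is bounded by the essential supremum, which is
  how pointwise information is passed to arbitrary functionals.
\<close>

lemma dual_ball_bound:
  assumes \<phi>: "\<phi> \<in> carrier (dual_space (Linf_space M))" "vnorm (dual_space (Linf_space M)) \<phi> \<le> 1"
    and g: "g \<in> Linf_fun M" and c: "0 \<le> c" "locally_AE M (\<lambda>t. cmod (g t) \<le> c)"
  shows "cmod (\<phi> (Linf_class M g)) \<le> c"
proof -
  have "op_bounds (Linf_space M) complex_space \<phi> \<noteq> {}"
    using \<phi> by (simp add: bounded_ops_def)
  then have "op_norm (Linf_space M) complex_space \<phi> \<in> op_bounds (Linf_space M) complex_space \<phi>"
    by (intro op_norm_in_op_bounds Linf_vnorm_nonneg)
  then have "cmod (\<phi> (Linf_class M g)) \<le>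
      op_norm (Linf_space M) complex_space \<phi> * vnorm (Linf_space M) (Linf_class M g)"
    using Linf_class_mem[OF g] by (simp add: op_bounds_def complex_space_def)
  also have "\<dots> \<le> 1 * vnorm (Linf_space M) (Linf_class M g)"
    using \<phi>(2) Linf_vnorm_nonneg[OF Linf_class_mem[OF g]]
    by (intro mult_right_mono) (simp_all add: dual_vnorm)
  also have "\<dots> \<le> c" using Linf_vnorm_le[OF g c] by simp
  finally show ?thesis .
qed

lemma dual_sum:
  assumes \<phi>: "\<phi> \<in> carrier (dual_space (Linf_space M))"
    and K: "finite K" and h: "\<And>k. k \<in> K \<Longrightarrow> h k \<in> Linf_fun M"
  shows "\<phi> (Linf_class M (\<lambda>t. \<Sum>k\<in>K. a k * h k t)) = (\<Sum>k\<in>K. a k * \<phi> (Linf_class M (h k)))"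
proof -
  have lin: "linear_map (Linf_space M) complex_space \<phi>" using \<phi> by (simp add: bounded_ops_def)
  have add: "\<phi> (Linf_class M (\<lambda>t. f t + g t)) = \<phi> (Linf_class M f) + \<phi> (Linf_class M g)"
    if fg: "f \<in> Linf_fun M" "g \<in> Linf_fun M" for f g
  proof -
    have "\<phi> (vadd (Linf_space M) (Linf_class M f) (Linf_class M g)) =
        \<phi> (Linf_class M f) + \<phi> (Linf_class M g)"
      using lin fg by (simp add: linear_map_def complex_space_def Linf_class_mem)
    then show ?thesis using fg by (simp add: Linf_vadd)
  qed
  have scale: "\<phi> (Linf_class M (\<lambda>t. c * f t)) = c * \<phi> (Linf_class M f)"
    if f: "f \<in> Linf_fun M" for f c
  proof -
    have "\<phi> (vscale (Linf_space M) c (Linf_class M f)) = c * \<phi> (Linf_class M f)"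
      using lin f by (simp add: linear_map_def complex_space_def Linf_class_mem)
    then show ?thesis using f by (simp add: Linf_vscale)
  qed
  show ?thesis
    using K h
  proof (induction K rule: finite_induct)
    case empty
    show ?case using scale[OF Linf_fun_zero, of 0] by simp
  next
    case (insert k K)
    then have "(\<lambda>t. a k * h k t) \<in> Linf_fun M" "(\<lambda>t. \<Sum>k\<in>K. a k * h k t) \<in> Linf_fun M"
      by (auto intro!: Linf_fun_scale Linf_fun_sum)
    with insert show ?case by (simp add: add scale)
  qed
qed

lemma dual_bilinear_form:
  fixes f :: "nat \<Rightarrow> nat \<Rightarrow> 'a \<Rightarrow> complex"
  assumes \<phi>: "\<phi> \<in> carrier (dual_space (Linf_space M))"
    and f: "\<And>i j. i < n \<Longrightarrow> j < n \<Longrightarrow> f i j \<in> Linf_fun M"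
  shows "(\<lambda>t. \<Sum>i<n. w i * (\<Sum>j<n. f i j t * z j)) \<in> Linf_fun M"
    and "\<phi> (Linf_class M (\<lambda>t. \<Sum>i<n. w i * (\<Sum>j<n. f i j t * z j))) =
      (\<Sum>i<n. w i * (\<Sum>j<n. \<phi> (Linf_class M (f i j)) * z j))"
proof -
  let ?K = "{..<n} \<times> {..<n}"
  \<comment> \<open>The form is a single linear combination of the matrix entries, to which linearity applies.\<close>
  have form: "(\<Sum>i<n. w i * (\<Sum>j<n. b i j * z j)) =
      (\<Sum>k\<in>?K. (w (fst k) * z (snd k)) * b (fst k) (snd k))" for b :: "nat \<Rightarrow> nat \<Rightarrow> complex"
    by (simp add: sum_distrib_left sum.cartesian_product case_prod_beta mult_ac)
  show "(\<lambda>t. \<Sum>i<n. w i * (\<Sum>j<n. f i j t * z j)) \<in> Linf_fun M"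
    unfolding form using f by (intro Linf_fun_sum Linf_fun_scale) auto
  show "\<phi> (Linf_class M (\<lambda>t. \<Sum>i<n. w i * (\<Sum>j<n. f i j t * z j))) =
      (\<Sum>i<n. w i * (\<Sum>j<n. \<phi> (Linf_class M (f i j)) * z j))"
    unfolding form using f by (intro dual_sum[OF \<phi>]) auto
qed

text \<open>
  The functional that an integrable \<open>k\<close> induces on L-infinity by integration; it is
  read off from an arbitrary representative of the class.
\<close>

definition integral_functional :: "'a measure \<Rightarrow> ('a \<Rightarrow> complex) \<Rightarrow> ('a \<Rightarrow> complex) set \<Rightarrow> complex" where
  "integral_functional M k =
     (\<lambda>A\<in>carrier (Linf_space M). the_elem ((\<lambda>g. \<integral>t. k t * g t \<partial>M) ` A))"

lemma integral_functional_integrable: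
  assumes k: "integrable M k" and g: "g \<in> Linf_fun M"
    and c: "0 \<le> c" "locally_AE M (\<lambda>t. cmod (g t) \<le> c)"
  shows "integrable M (\<lambda>t. k t * g t)"
    and "cmod (\<integral>t. k t * g t \<partial>M) \<le> c * (\<integral>t. cmod (k t) \<partial>M)"
proof -
  have [measurable]: "k \<in> borel_measurable M" "g \<in> borel_measurable M"
    using k g by (auto simp: Linf_fun_def)
  have ae: "AE t in M. cmod (k t * g t) \<le> c * cmod (k t)"
    using locally_AE_on_support[OF k c(2)]
  proof eventually_elim
    case (elim t)
    then show ?case
      by (cases "k t = 0") (auto simp: norm_mult mult.commute intro: mult_left_mono)
  qed
  have kint: "integrable M (\<lambda>t. c * cmod (k t))" using k by simp
  then show int: "integrable M (\<lambda>t. k t * g t)"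
    by (rule Bochner_Integration.integrable_bound) (use ae c in \<open>auto simp: abs_mult\<close>)
  have "cmod (\<integral>t. k t * g t \<partial>M) \<le> (\<integral>t. cmod (k t * g t) \<partial>M)" by (rule integral_norm_bound)
  also have "\<dots> \<le> (\<integral>t. c * cmod (k t) \<partial>M)"
    using int kint ae by (intro integral_mono_AE) auto
  finally show "cmod (\<integral>t. k t * g t \<partial>M) \<le> c * (\<integral>t. cmod (k t) \<partial>M)" by simp
qed

lemma integral_functional_class:
  assumes k: "integrable M k" and g: "g \<in> Linf_fun M"
  shows "integral_functional M k (Linf_class M g) = (\<integral>t. k t * g t \<partial>M)"
proof -
  have "(\<integral>t. k t * g' t \<partial>M) = (\<integral>t. k t * g t \<partial>M)" if g': "(g, g') \<in> Linf_rel M" for g'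
  proof (rule integral_cong_AE)
    have "locally_AE M (\<lambda>t. g t = g' t)" using g' by (simp add: Linf_rel_def)
    from locally_AE_on_support[OF k this] show "AE t in M. k t * g' t = k t * g t"
      by eventually_elim auto
  qed (use k g' in \<open>auto simp: Linf_rel_def Linf_fun_def intro!: borel_measurable_times\<close>)
  then have "the_elem ((\<lambda>g. \<integral>t. k t * g t \<partial>M) ` Linf_class M g) = (\<integral>t. k t * g t \<partial>M)"
    by (rule Linf_the_elem_class[OF g])
  then show ?thesis using Linf_class_mem[OF g] by (simp add: integral_functional_def)
qed

lemma integral_functional_dual:
  assumes k: "integrable M k"
  shows "integral_functional M k \<in> carrier (dual_space (Linf_space M))"
    and "vnorm (dual_space (Linf_space M)) (integral_functional M k) \<le> (\<integral>t. cmod (k t) \<partial>M)"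
proof -
  have int: "integrable M (\<lambda>t. k t * g t)" if "g \<in> Linf_fun M" for g
    using Linf_fun_bound[OF that] integral_functional_integrable(1)[OF k that] by blast
  have lin: "linear_map (Linf_space M) complex_space (integral_functional M k)"
    unfolding linear_map_def
  proof (intro conjI ballI allI funcsetI)
    fix A assume A: "A \<in> carrier (Linf_space M)"
    show "integral_functional M k A \<in> carrier complex_space" by (simp add: complex_space_def)
    obtain f where f: "f \<in> Linf_fun M" "A = Linf_class M f" using Linf_carrier_cases[OF A] .
    show "integral_functional M k (vscale (Linf_space M) c A) =
        vscale complex_space c (integral_functional M k A)" for c
      using k f
      by (simp add: Linf_vscale integral_functional_class Linf_fun_scale complex_space_def
          mult.left_commute)
    fix B assume B: "B \<in> carrier (Linf_space M)"
    obtain g where g: "g \<in> Linf_fun M" "B = Linf_class M g" using Linf_carrier_cases[OF B] .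
    show "integral_functional M k (vadd (Linf_space M) A B) =
        vadd complex_space (integral_functional M k A) (integral_functional M k B)"
      using k f g int[OF f(1)] int[OF g(1)]
      by (simp add: Linf_vadd integral_functional_class Linf_fun_add complex_space_def distrib_left)
  qed
  have "cmod (integral_functional M k A) \<le> (\<integral>t. cmod (k t) \<partial>M) * vnorm (Linf_space M) A"
    if A: "A \<in> carrier (Linf_space M)" for A
  proof -
    obtain f where f: "f \<in> Linf_fun M" "A = Linf_class M f" using Linf_carrier_cases[OF A] .
    show ?thesis
      using integral_functional_integrable(2)[OF k f(1) Linf_vnorm_nonneg_and_bound[OF f(1)]] k f
      by (simp add: integral_functional_class mult.commute)
  qed
  then have bnd: "(\<integral>t. cmod (k t) \<partial>M) \<in> op_bounds (Linf_space M) complex_space (integral_functional M k)"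
    by (simp add: op_bounds_def complex_space_def integral_nonneg_AE)
  then show "integral_functional M k \<in> carrier (dual_space (Linf_space M))"
    using lin by (auto simp: bounded_ops_def integral_functional_def)
  show "vnorm (dual_space (Linf_space M)) (integral_functional M k) \<le> (\<integral>t. cmod (k t) \<partial>M)"
    unfolding dual_vnorm using bnd by (rule op_norm_le)
qed

text \<open>
  Functionals given by integrable functions already norm L-infinity. If
  \<open>cmod (g t) > c\<close> on a set \<open>B\<close> of finite positive measure, the functional with
  density \<open>cnj (sgn g)\<close> on \<open>B\<close>, normalised by the measure of \<open>B\<close>, lies in the unit ball
  and maps \<open>g\<close> to the average of \<open>cmod g\<close> over \<open>B\<close>, which would exceed \<open>c\<close>.
\<close>

lemma locally_AE_bound_from_dual_ball:
  assumes g: "g \<in> Linf_fun M"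
    and bound: "\<And>\<phi>. \<phi> \<in> carrier (dual_space (Linf_space M)) \<Longrightarrow>
      vnorm (dual_space (Linf_space M)) \<phi> \<le> 1 \<Longrightarrow> cmod (\<phi> (Linf_class M g)) \<le> c"
  shows "locally_AE M (\<lambda>t. cmod (g t) \<le> c)"
proof
  fix E assume E [measurable]: "E \<in> sets M" and Efin: "emeasure M E < \<infinity>"
  have [measurable]: "g \<in> borel_measurable M" using g by (rule Linf_fun_measurable)
  define B where "B = {t \<in> E. c < cmod (g t)}"
  have B_sets [measurable]: "B \<in> sets M" and Bfin: "emeasure M B < \<infinity>"
    unfolding B_def by (rule superlevel_set_finite_measure[OF _ E Efin], measurable)+
  show "AE t in M. t \<in> E \<longrightarrow> cmod (g t) \<le> c"
  proof (cases "measure M B = 0")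
    case True
    then have "B \<in> null_sets M"
      using Bfin by (auto simp: null_sets_def measure_def enn2real_eq_0_iff)
    then have "AE t in M. t \<notin> B" by (rule AE_not_in)
    then show ?thesis by eventually_elim (auto simp: B_def)
  next
    case False
    then have pos: "measure M B > 0" using zero_less_measure_iff by blast
    \<comment> \<open>Normalised so that the integral of \<open>cmod k\<close> is at most 1 and \<open>k * g\<close> is \<open>cmod g / measure M B\<close> on \<open>B\<close>.\<close>
    define k where "k t = of_real (indicator B t / measure M B) * cnj (sgn (g t))" for t
    have indint: "integrable M (\<lambda>t. indicator B t / measure M B)" using Bfin by simp
    have k_le: "cmod (k t) \<le> indicator B t / measure M B" for t
      by (auto simp: k_def norm_mult norm_divide norm_sgn indicator_def divide_simps)
    have [measurable]: "cnj \<in> borel_measurable borel"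
      by (intro borel_measurable_continuous_onI continuous_intros)
    have [measurable]: "k \<in> borel_measurable M" unfolding k_def sgn_eq by measurable
    have kint: "integrable M k"
      using indint by (rule Bochner_Integration.integrable_bound) (use k_le in \<open>auto intro: order_trans\<close>)
    have "(\<integral>t. cmod (k t) \<partial>M) \<le> (\<integral>t. indicator B t / measure M B \<partial>M)"
      using kint indint k_le by (intro integral_mono) auto
    also have "\<dots> = 1"
      using pos sets.sets_into_space[OF B_sets] by (simp add: Int_absorb2)
    finally have "cmod (integral_functional M k (Linf_class M g)) \<le> c"
      using integral_functional_dual[OF kint] by (intro bound) auto
    then have "cmod (\<integral>t. k t * g t \<partial>M) \<le> c"
      using kint g by (simp add: integral_functional_class)
    moreover have kg: "k t * g t = of_real (indicator B t * cmod (g t) / measure M B)" for t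
    proof -
      have "k t * g t = of_real (indicator B t / measure M B) * (cnj (sgn (g t)) * g t)"
        by (simp add: k_def mult.assoc)
      then show ?thesis by (simp only: cnj_sgn_mult) simp
    qed
    moreover have "(\<integral>t. k t * g t \<partial>M) = of_real ((\<integral>t. indicator B t * cmod (g t) \<partial>M) / measure M B)"
      unfolding kg integral_complex_of_real by simp
    ultimately have "\<bar>(\<integral>t. indicator B t * cmod (g t) \<partial>M) / measure M B\<bar> \<le> c"
      by (simp only: norm_of_real)
    then have le: "(\<integral>t. indicator B t * cmod (g t) \<partial>M) \<le> c * measure M B"
      using pos by (simp add: abs_le_iff pos_divide_le_eq)
    have "integrable M (\<lambda>t. k t * g t)"
      using Linf_fun_bound[OF g] integral_functional_integrable(1)[OF kint g] by blast
    then have "integrable M (\<lambda>t. measure M B * cmod (k t * g t))"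
      by (intro integrable_mult_right integrable_norm)
    then have "integrable M (\<lambda>t. indicator B t * cmod (g t))"
      unfolding kg norm_of_real using pos by (simp add: abs_mult)
    from AE_le_from_integral_le[OF _ E Efin B_def this le] show ?thesis by simp
  qed
qed


section \<open>Comparison of the two matrix norms\<close>

text \<open>
  For fixed vectors \<open>z\<close> and \<open>w\<close> the number obtained by pairing \<open>w\<close> with the scalar matrix
  applied to \<open>z\<close> is the value of \<open>\<phi>\<close> at the function
  \<open>\<Sum>i. w i * (\<Sum>j. f i j t * z j)\<close>. Hoelder's inequality and the pointwise bound control
  the essential supremum of that function, and \<open>\<phi>\<close> does not increase it.
\<close>

lemma scalar_matrix_norm_dual_le:
  assumes p: "p > 1" and f: "\<And>i j. i < n \<Longrightarrow> j < n \<Longrightarrow> f i j \<in> Linf_fun M"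
    and \<phi>: "\<phi> \<in> carrier (dual_space (Linf_space M))" "vnorm (dual_space (Linf_space M)) \<phi> \<le> 1"
    and c: "c \<in> op_bounds (lp_sum p n (Lp_space p M)) (lp_sum p n (Lp_space p M))
      (operator_matrix_op n (Lp_space p M) (\<lambda>i j. mult_rep p M (Linf_class M (f i j))))"
  shows "scalar_matrix_norm p n (\<lambda>i j. \<phi> (Linf_class M (f i j))) \<le> c"
proof (rule scalar_matrix_norm_le)
  show c0: "0 \<le> c" using c by (simp add: op_bounds_def)
  fix z
  define q where "q = p / (p - 1)"
  have q: "q > 1" and pq: "1 / p + 1 / q = 1" using p by (simp_all add: q_def field_simps)
  show "lp_norm p n (\<lambda>i. \<Sum>j<n. \<phi> (Linf_class M (f i j)) * z j) \<le> c * lp_norm p n z"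
  proof (rule lp_norm_le_by_duality[OF p q pq])
    fix w
    have "locally_AE M (\<lambda>t. lp_norm p n (\<lambda>i. \<Sum>j<n. f i j t * z j) \<le> c * lp_norm p n z)"
      using p f c by (intro pointwise_bound_from_mult_matrix) auto
    then have "locally_AE M (\<lambda>t. cmod (\<Sum>i<n. w i * (\<Sum>j<n. f i j t * z j)) \<le>
        c * lp_norm p n z * lp_norm q n w)"
    proof (rule locally_AE_mp)
      fix t assume le: "lp_norm p n (\<lambda>i. \<Sum>j<n. f i j t * z j) \<le> c * lp_norm p n z"
      have "cmod (\<Sum>i<n. w i * (\<Sum>j<n. f i j t * z j)) \<le>
          lp_norm q n w * lp_norm p n (\<lambda>i. \<Sum>j<n. f i j t * z j)"
        by (rule lp_norm_Holder[OF p q pq])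
      also have "\<dots> \<le> lp_norm q n w * (c * lp_norm p n z)"
        using le by (intro mult_left_mono) auto
      finally show "cmod (\<Sum>i<n. w i * (\<Sum>j<n. f i j t * z j)) \<le> c * lp_norm p n z * lp_norm q n w"
        by (simp add: mult_ac)
    qed
    then have "cmod (\<phi> (Linf_class M (\<lambda>t. \<Sum>i<n. w i * (\<Sum>j<n. f i j t * z j)))) \<le>
        c * lp_norm p n z * lp_norm q n w"
      using c0 by (intro dual_ball_bound[OF \<phi> dual_bilinear_form(1)[OF \<phi>(1), where f = f, OF f]]) auto
    then show "cmod (\<Sum>i<n. w i * (\<Sum>j<n. \<phi> (Linf_class M (f i j)) * z j)) \<le>
        c * lp_norm p n z * lp_norm q n w"
      by (simp add: dual_bilinear_form(2)[OF \<phi>(1), where f = f, OF f])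
  qed (use c0 in simp)
qed

text \<open>
  The converse estimate. For fixed \<open>z\<close> and \<open>w\<close> the function
  \<open>\<Sum>i. w i * (\<Sum>j. f i j t * z j)\<close> is normed by functionals, which bounds it locally
  almost everywhere. Doing this for countably many \<open>z\<close> and \<open>w\<close> at once yields, in each
  set of finite measure, a single null set off which the scalar matrices are bounded by \<open>m\<close>.
\<close>

lemma mult_matrix_bound_from_dual_ball:
  assumes p: "p > 1" and f: "\<And>i j. i < n \<Longrightarrow> j < n \<Longrightarrow> f i j \<in> Linf_fun M" and m: "0 \<le> m"
    and bound: "\<And>\<phi>. \<phi> \<in> carrier (dual_space (Linf_space M)) \<Longrightarrow>
      vnorm (dual_space (Linf_space M)) \<phi> \<le> 1 \<Longrightarrow>
      scalar_matrix_norm p n (\<lambda>i j. \<phi> (Linf_class M (f i j))) \<le> m"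
  shows "m \<in> op_bounds (lp_sum p n (Lp_space p M)) (lp_sum p n (Lp_space p M))
      (operator_matrix_op n (Lp_space p M) (\<lambda>i j. mult_rep p M (Linf_class M (f i j))))"
proof -
  have p0: "p > 0" using p by simp
  define q where "q = p / (p - 1)"
  have q: "q > 1" and pq: "1 / p + 1 / q = 1" using p by (simp_all add: q_def field_simps)
  obtain D :: "(nat \<Rightarrow> complex) set" where D: "countable D"
    "\<And>z. \<exists>s. (\<forall>k. s k \<in> D) \<and> (\<forall>i<n. (\<lambda>k. s k i) \<longlonglongrightarrow> z i)"
    using countable_dense_vectors[of n] by blast
  have form: "locally_AE M (\<lambda>t. cmod (\<Sum>i<n. w i * (\<Sum>j<n. f i j t * z j)) \<le>
      m * lp_norm p n z * lp_norm q n w)" for z w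
  proof (rule locally_AE_bound_from_dual_ball)
    show "(\<lambda>t. \<Sum>i<n. w i * (\<Sum>j<n. f i j t * z j)) \<in> Linf_fun M"
      using integral_functional_dual(1)[of M "\<lambda>t. 0"] f
      by (intro dual_bilinear_form(1)) auto
  next
    fix \<phi> assume \<phi>: "\<phi> \<in> carrier (dual_space (Linf_space M))"
      "vnorm (dual_space (Linf_space M)) \<phi> \<le> 1"
    let ?a = "\<lambda>i j. \<phi> (Linf_class M (f i j))"
    have "cmod (\<phi> (Linf_class M (\<lambda>t. \<Sum>i<n. w i * (\<Sum>j<n. f i j t * z j)))) =
        cmod (\<Sum>i<n. w i * (\<Sum>j<n. ?a i j * z j))"
      by (simp add: dual_bilinear_form(2)[OF \<phi>(1), where f = f, OF f])
    also have "\<dots> \<le> lp_norm q n w * lp_norm p n (\<lambda>i. \<Sum>j<n. ?a i j * z j)"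
      by (rule lp_norm_Holder[OF p q pq])
    also have "\<dots> \<le> lp_norm q n w * (scalar_matrix_norm p n ?a * lp_norm p n z)"
      by (intro mult_left_mono scalar_matrix_norm_bound(2)[OF p0]) simp
    also have "\<dots> \<le> lp_norm q n w * (m * lp_norm p n z)"
      using bound[OF \<phi>] by (intro mult_left_mono mult_right_mono) auto
    finally show "cmod (\<phi> (Linf_class M (\<lambda>t. \<Sum>i<n. w i * (\<Sum>j<n. f i j t * z j)))) \<le>
        m * lp_norm p n z * lp_norm q n w" by (simp add: mult_ac)
  qed
  have "locally_AE M (\<lambda>t. \<forall>k\<in>D \<times> D. cmod (\<Sum>i<n. snd k i * (\<Sum>j<n. f i j t * fst k j)) \<le>
      m * lp_norm p n (fst k) * lp_norm q n (snd k))"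
    using D(1) form by (intro locally_AE_ball_countable) auto
  then have "locally_AE M (\<lambda>t. \<forall>z. lp_norm p n (\<lambda>i. \<Sum>j<n. f i j t * z j) \<le> m * lp_norm p n z)"
  proof (rule locally_AE_mp, intro allI)
    fix t z
    assume *: "\<forall>k\<in>D \<times> D. cmod (\<Sum>i<n. snd k i * (\<Sum>j<n. f i j t * fst k j)) \<le>
      m * lp_norm p n (fst k) * lp_norm q n (snd k)"
    show "lp_norm p n (\<lambda>i. \<Sum>j<n. f i j t * z j) \<le> m * lp_norm p n z"
      by (rule lp_norm_bound_from_dense_forms[OF p q pq m D(2)]) (use * in force)
  qed
  then show ?thesis using p0 f m by (intro mult_matrix_bound_from_pointwise) auto
qed

lemma min_norm_eq_mult_matrix_norm:
  assumes p: "p > 1" and f: "\<And>i j. i < n \<Longrightarrow> j < n \<Longrightarrow> f i j \<in> Linf_fun M"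
  shows "op_norm (lp_sum p n (Lp_space p M)) (lp_sum p n (Lp_space p M))
      (operator_matrix_op n (Lp_space p M) (\<lambda>i j. mult_rep p M (Linf_class M (f i j)))) =
    (SUP \<phi>\<in>{\<phi> \<in> carrier (dual_space (Linf_space M)). vnorm (dual_space (Linf_space M)) \<phi> \<le> 1}.
      scalar_matrix_norm p n (\<lambda>i j. \<phi> (Linf_class M (f i j))))"
    (is "op_norm ?S ?S ?T = (SUP \<phi>\<in>?ball. ?N \<phi>)")
proof (rule antisym)
  have p0: "p > 0" using p by simp
  \<comment> \<open>The zero functional, given by the density 0, shows that the supremum is over a nonempty set.\<close>
  have zero: "integral_functional M (\<lambda>t. 0) \<in> ?ball"
    using integral_functional_dual[of M "\<lambda>t. 0"] by auto
  have le: "?N \<phi> \<le> c" if "\<phi> \<in> ?ball" "c \<in> op_bounds ?S ?S ?T" for \<phi> c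
    using that p f by (intro scalar_matrix_norm_dual_le) auto
  obtain c where c: "c \<in> op_bounds ?S ?S ?T" using mult_matrix_bounded[OF p0, where f = f, OF f] by blast
  then have bdd: "bdd_above (?N ` ?ball)" using le by (auto simp: bdd_above_def)
  have upper: "?N \<phi> \<le> (SUP \<phi>\<in>?ball. ?N \<phi>)" if "\<phi> \<in> ?ball" for \<phi>
    using that bdd by (rule cSUP_upper)
  show "op_norm ?S ?S ?T \<le> (SUP \<phi>\<in>?ball. ?N \<phi>)"
  proof (rule op_norm_le, rule mult_matrix_bound_from_dual_ball[OF p, where f = f, OF f])
    show "0 \<le> (SUP \<phi>\<in>?ball. ?N \<phi>)"
      using upper[OF zero] scalar_matrix_norm_bound(1)[OF p0] by (rule order_trans[rotated])
  qed (use upper in auto)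
  show "(SUP \<phi>\<in>?ball. ?N \<phi>) \<le> op_norm ?S ?S ?T"
  proof (rule cSUP_least)
    show "?ball \<noteq> {}" using zero by blast
    fix \<phi> assume "\<phi> \<in> ?ball"
    then show "?N \<phi> \<le> op_norm ?S ?S ?T"
      unfolding op_norm_def using c le by (intro cInf_greatest) auto
  qed
qed

theorem theorem1p3:
  fixes p :: real and M :: "'a measure" and I :: "'i set" and F :: "'i \<Rightarrow> 'a set"
  assumes "1 < p" and "decomposable_measure M I F"
  shows "complete_isometry (min_p_op_space p (Linf_space M))
           (ops_p_op_space p (Lp_space p M)) (mult_rep p M)"
  unfolding complete_isometry_def
proof (intro conjI allI impI ballI)
  have "linear_map (Linf_space M) (bounded_ops (Lp_space p M) (Lp_space p M)) (mult_rep p M)"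
    using assms(1) by (intro mult_rep_linear) simp
  then show "linear_map (min_p_op_space p (Linf_space M)) (ops_p_op_space p (Lp_space p M))
      (mult_rep p M)"
    by (simp add: linear_map_def min_p_op_space_def ops_p_op_space_def
        cnspace.defs p_op_space.defs)
  fix n u assume u: "u \<in> matrices n (min_p_op_space p (Linf_space M))"
  have "\<exists>f. f \<in> Linf_fun M \<and> u i j = Linf_class M f" if "i < n" "j < n" for i j
  proof -
    have "u i j \<in> carrier (Linf_space M)"
      using u that by (simp add: matrices_def min_p_op_space_def cnspace.defs)
    then show ?thesis using Linf_carrier_cases by metis
  qed
  then obtain f where f: "\<And>i j. i < n \<Longrightarrow> j < n \<Longrightarrow> f i j \<in> Linf_fun M"
    and uf: "\<And>i j. i < n \<Longrightarrow> j < n \<Longrightarrow> u i j = Linf_class M (f i j)"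
    by metis
  have "operator_matrix_op n (Lp_space p M) (amplification (mult_rep p M) u) =
      operator_matrix_op n (Lp_space p M) (\<lambda>i j. mult_rep p M (Linf_class M (f i j)))"
    unfolding operator_matrix_op_def amplification_def
    by (intro ext restrict_ext vsum_cong) (simp add: uf)
  moreover have "scalar_matrix_norm p n (\<lambda>i j. \<phi> (u i j)) =
      scalar_matrix_norm p n (\<lambda>i j. \<phi> (Linf_class M (f i j)))" for \<phi>
  proof -
    have "scalar_matrix_op n (\<lambda>i j. \<phi> (u i j)) =
        scalar_matrix_op n (\<lambda>i j. \<phi> (Linf_class M (f i j)))"
      unfolding scalar_matrix_op_def by (intro ext restrict_ext sum.cong) (auto simp: uf)
    then show ?thesis by (simp add: scalar_matrix_norm_def)
  qed
  ultimately show "mnorm (ops_p_op_space p (Lp_space p M)) n (amplification (mult_rep p M) u) =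
      mnorm (min_p_op_space p (Linf_space M)) n u"
    using min_norm_eq_mult_matrix_norm[OF assms(1), where f = f, OF f]
    by (simp add: ops_p_op_space_def min_p_op_space_def cnspace.defs p_op_space.defs)
qed

end
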